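(* Let $W$ be a Weyl tensor of type IM$^{[-6]}$, with eigenvalues $\rho_1,\rho_2,\rho_3$ and orthonormal frame $\{\mathcal U_i\}$ of self-dual eigenbivectors, so that $\mathcal W=-\sum_{i}\rho_i\,\mathcal U_i\otimes\mathcal U_i$. Put $t=|\rho_1|^2=|\rho_2|^2=|\rho_3|^2$, $\tau=\rho_1\overline\rho_2=\rho_2\overline\rho_3=\rho_3\overline\rho_1$, $\Pi_i=\mathcal U_i\cdot\overline{\mathcal U}_i$, $\Pi_{jk}=\mathcal U_j\cdot\overline{\mathcal U}_k$. Then the Bel-Robinson tensor $T$ of $W$ admits the canonical expression $$\begin{aligned}T={}&t(\Pi_1\otimes\Pi_1+\Pi_2\otimes\Pi_2+\Pi_3\otimes\Pi_3)+\tau(\Pi_{12}\otimes\Pi_{12}+\Pi_{23}\otimes\Pi_{23}+\Pi_{31}\otimes\Pi_{31})\\&+\overline\tau(\Pi_{21}\otimes\Pi_{21}+\Pi_{32}\otimes\Pi_{32}+\Pi_{13}\otimes\Pi_{13}).\end{aligned}$$ Associated with the eigenvalues $t$, $\tau$ and $\overline\tau$ we have, respectively, the three-dimensional eigenspaces $P_t=\langle\Pi_1,\Pi_2,\Pi_3\rangle$, $P_\tau=\langle\Pi_{12},\Pi_{23},\Pi_{31}\rangle$ and $P_{\overline\tau}=\langle\Pi_{21},\Pi_{32},\Pi_{13}\rangle$.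
   Context: $(V,g)$ is an oriented 4-dimensional real vector space with a Lorentzian metric of signature $(-,+,+,+)$ (the tangent space of a space-time at a point); indices are moved with $g$; $\eta$ is the metric volume element; $( *F)_{\alpha\beta}=\frac12\eta_{\alpha\beta\mu\nu}F^{\mu\nu}$, $( *W)_{\alpha\beta\mu\nu}=\frac12\eta_{\alpha\beta}{}^{\rho\sigma}W_{\rho\sigma\mu\nu}$. A self-dual (SD) bivector is a complex 2-form $\mathcal F$ with $*\mathcal F=\mathrm i\mathcal F$; these form a complex 3-dimensional space with metric $\mathcal G(\mathcal F,\mathcal H)=\frac12\mathcal F_{\alpha\beta}\mathcal H^{\alpha\beta}$. A frame $\{\mathcal U_i\}$ of SD bivectors is orthonormal if $\mathcal G(\mathcal U_i,\mathcal U_j)=-\delta_{ij}$. A Weyl tensor $W$ is a real 4-tensor with the algebraic symmetries of a Riemann tensor and vanishing traces; $\mathcal W=\frac12(W-\mathrm i*W)$ acts on SD bivectors by $\mathcal W(\mathcal F)_{\alpha\beta}=\frac12\mathcal W_{\alpha\beta}{}^{\mu\nu}\mathcal F_{\mu\nu}$, with eigenvalues $\rho_i$, $\sum\rho_i=0$. Put $a=\operatorname{Tr}\mathcal W^2=\sum\rho_i^2$, $b=\operatorname{Tr}\mathcal W^3=\sum\rho_i^3$, $M=a^3/b^2-6$. $W$ is of type IM$^{[-6]}$ if $M=-6$, i.e. $a=0$ and $b\neq0$ (the three eigenvalues are then nonzero and differ by cubic roots of unity). The Bel-Robinson (BR) tensor of $W$ is $T_{\alpha\mu\beta\nu}=\mathcal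 W_{\alpha}{}^{\rho}{}_{\beta}{}^{\sigma}\,\overline{\mathcal W}_{\mu\rho\nu\sigma}$; it is totally symmetric and traceless and acts on the (complexified) 9-dimensional space of traceless symmetric 2-tensors by $T(A)_{\alpha\beta}=T_{\alpha\beta}{}^{\mu\nu}A_{\mu\nu}$. For 2-tensors $(A\cdot B)_{\alpha\beta}=A_{\alpha}{}^{\mu}B_{\mu\beta}$. $\langle\cdot\rangle$ denotes (complex) linear span. *)

theory Defs
  imports "HOL-Analysis.Analysis"
begin

text \<open>
  Tensors over the oriented Lorentzian space \<open>V\<close> are given by their components in an arbitrary
  basis, indexed by the four elements \<open>0, 1, 2, 3\<close> of the type \<open>4\<close>. The metric is an arbitrary
  symmetric matrix of signature (-,+,+,+), not necessarily the Minkowski one, and \<open>s\<close> is the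
  orientation of the basis (1 if it is positively oriented, -1 otherwise). Unless said otherwise
  all components are covariant and indices are moved explicitly with \<^term>\<open>matrix_inv g\<close>.
\<close>

type_synonym tensor2 = "complex^4^4"
type_synonym tensor4 = "4 \<Rightarrow> 4 \<Rightarrow> 4 \<Rightarrow> 4 \<Rightarrow> complex"
type_synonym real_tensor4 = "4 \<Rightarrow> 4 \<Rightarrow> 4 \<Rightarrow> 4 \<Rightarrow> real"

definition tscale :: "complex \<Rightarrow> tensor2 \<Rightarrow> tensor2" where
  "tscale c A = (\<chi> a b. c * A $ a $ b)"

text \<open>
  Span, linear independence and dimension over the complex numbers; the unqualified library
  notions on this type are the real ones.
\<close>

global_interpretation tensor2: vector_space tscale
  by unfold_locales (simp_all add: tscale_def vec_eq_iff algebra_simps)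

definition tconj :: "tensor2 \<Rightarrow> tensor2" where
  "tconj A = (\<chi> a b. cnj (A $ a $ b))"

definition lorentzian :: "real^4^4 \<Rightarrow> bool" where
  "lorentzian g \<longleftrightarrow> transpose g = g \<and>
     (\<exists>P :: real^4^4. invertible P \<and>
        transpose P ** g ** P = (\<chi> a b. if a = b then if a = 0 then - 1 else 1 else 0))"

definition ginv :: "real^4^4 \<Rightarrow> 4 \<Rightarrow> 4 \<Rightarrow> complex" where
  "ginv g a b = complex_of_real (matrix_inv g $ a $ b)"

text \<open>Normalised by \<open>levi_civita 0 1 2 3 = 1\<close>.\<close>

definition levi_civita :: "4 \<Rightarrow> 4 \<Rightarrow> 4 \<Rightarrow> 4 \<Rightarrow> real" where
  "levi_civita a b c d =
     det (\<chi> i. axis (if i = 0 then a else if i = 1 then b else if i = 2 then c else d) 1)"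

definition volume_element :: "real \<Rightarrow> real^4^4 \<Rightarrow> real_tensor4" where
  "volume_element s g a b c d = s * sqrt \<bar>det g\<bar> * levi_civita a b c d"

definition raise2 :: "real^4^4 \<Rightarrow> tensor2 \<Rightarrow> tensor2" where
  "raise2 g A = (\<chi> m n. \<Sum>k\<in>UNIV. \<Sum>l\<in>UNIV. ginv g m k * ginv g n l * A $ k $ l)"

text \<open>Raises the last two indices: \<open>X\<^sub>a\<^sub>b\<^sup>m\<^sup>n\<close>.\<close>

definition raise34 :: "real^4^4 \<Rightarrow> tensor4 \<Rightarrow> tensor4" where
  "raise34 g X a b m n = (\<Sum>k\<in>UNIV. \<Sum>l\<in>UNIV. ginv g m k * ginv g n l * X a b k l)"

definition tprod :: "real^4^4 \<Rightarrow> tensor2 \<Rightarrow> tensor2 \<Rightarrow> tensor2" where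
  "tprod g A B = (\<chi> a b. \<Sum>m\<in>UNIV. \<Sum>n\<in>UNIV. A $ a $ n * ginv g n m * B $ m $ b)"

definition outer :: "tensor2 \<Rightarrow> tensor2 \<Rightarrow> tensor4" where
  "outer A B a b c d = A $ a $ b * B $ c $ d"

definition traceless_symmetric :: "real^4^4 \<Rightarrow> tensor2 set" where
  "traceless_symmetric g =
     {A. transpose A = A \<and> (\<Sum>a\<in>UNIV. \<Sum>b\<in>UNIV. ginv g a b * A $ a $ b) = 0}"

definition star2 :: "real \<Rightarrow> real^4^4 \<Rightarrow> tensor2 \<Rightarrow> tensor2" where
  "star2 s g F = (\<chi> a b. 1/2 * (\<Sum>m\<in>UNIV. \<Sum>n\<in>UNIV.
     complex_of_real (volume_element s g a b m n) * raise2 g F $ m $ n))"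

definition self_dual_bivectors :: "real \<Rightarrow> real^4^4 \<Rightarrow> tensor2 set" where
  "self_dual_bivectors s g = {F. transpose F = - F \<and> star2 s g F = tscale \<i> F}"

definition bivector_metric :: "real^4^4 \<Rightarrow> tensor2 \<Rightarrow> tensor2 \<Rightarrow> complex" where
  "bivector_metric g F H = 1/2 * (\<Sum>a\<in>UNIV. \<Sum>b\<in>UNIV. F $ a $ b * raise2 g H $ a $ b)"

text \<open>A frame is indexed by the type \<open>3\<close>, whose elements are \<open>1, 2, 3\<close> (with \<open>3 = 0\<close>).\<close>

definition orthonormal_sd_frame :: "real \<Rightarrow> real^4^4 \<Rightarrow> (3 \<Rightarrow> tensor2) \<Rightarrow> bool" where
  "orthonormal_sd_frame s g U \<longleftrightarrow>
     inj U \<and> tensor2.independent (range U) \<and> tensor2.span (range U) = self_dual_bivectors s g \<and>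
     (\<forall>i j. bivector_metric g (U i) (U j) = (if i = j then - 1 else 0))"

definition weyl_tensor :: "real^4^4 \<Rightarrow> real_tensor4 \<Rightarrow> bool" where
  "weyl_tensor g W \<longleftrightarrow>
     (\<forall>a b c d. W a b c d = - W b a c d \<and> W a b c d = - W a b d c \<and> W a b c d = W c d a b) \<and>
     (\<forall>a b c d. W a b c d + W a c d b + W a d b c = 0) \<and>
     (\<forall>b d. (\<Sum>a\<in>UNIV. \<Sum>c\<in>UNIV. matrix_inv g $ a $ c * W a b c d) = 0)"

definition star4 :: "real \<Rightarrow> real^4^4 \<Rightarrow> real_tensor4 \<Rightarrow> tensor4" where
  "star4 s g W a b m n = 1/2 * (\<Sum>p\<in>UNIV. \<Sum>q\<in>UNIV.
     raise34 g (\<lambda>a b c d. complex_of_real (volume_element s g a b c d)) a b p q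
       * complex_of_real (W p q m n))"

definition sd_weyl :: "real \<Rightarrow> real^4^4 \<Rightarrow> real_tensor4 \<Rightarrow> tensor4" where
  "sd_weyl s g W a b m n = 1/2 * (complex_of_real (W a b m n) - \<i> * star4 s g W a b m n)"

definition sd_weyl_map :: "real \<Rightarrow> real^4^4 \<Rightarrow> real_tensor4 \<Rightarrow> tensor2 \<Rightarrow> tensor2" where
  "sd_weyl_map s g W F =
     (\<chi> a b. 1/2 * (\<Sum>m\<in>UNIV. \<Sum>n\<in>UNIV. raise34 g (sd_weyl s g W) a b m n * F $ m $ n))"

text \<open>
  The trace of a linear map \<open>f\<close> that leaves the subspace \<open>S\<close> invariant, computed in some basis
  of \<open>S\<close> (the value does not depend on which one).
\<close>

definition trace_on :: "tensor2 set \<Rightarrow> (tensor2 \<Rightarrow> tensor2) \<Rightarrow> complex" where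
  "trace_on S f =
     (let B = (SOME B. tensor2.independent B \<and> tensor2.span B = S)
      in \<Sum>v\<in>B. tensor2.representation B (f v) v)"

definition weyl_a :: "real \<Rightarrow> real^4^4 \<Rightarrow> real_tensor4 \<Rightarrow> complex" where
  "weyl_a s g W = trace_on (self_dual_bivectors s g) (sd_weyl_map s g W ^^ 2)"

definition weyl_b :: "real \<Rightarrow> real^4^4 \<Rightarrow> real_tensor4 \<Rightarrow> complex" where
  "weyl_b s g W = trace_on (self_dual_bivectors s g) (sd_weyl_map s g W ^^ 3)"

definition weyl_M :: "real \<Rightarrow> real^4^4 \<Rightarrow> real_tensor4 \<Rightarrow> complex" where
  "weyl_M s g W = weyl_a s g W ^ 3 / weyl_b s g W ^ 2 - 6"

text \<open>Without the condition on \<^const>\<open>weyl_b\<close>, division by zero would give \<open>M = - 6\<close>.\<close>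

definition type_IM_minus6 :: "real \<Rightarrow> real^4^4 \<Rightarrow> real_tensor4 \<Rightarrow> bool" where
  "type_IM_minus6 s g W \<longleftrightarrow> weyl_b s g W \<noteq> 0 \<and> weyl_M s g W = - 6"

definition bel_robinson :: "real \<Rightarrow> real^4^4 \<Rightarrow> real_tensor4 \<Rightarrow> tensor4" where
  "bel_robinson s g W a m b n =
     (\<Sum>k\<in>UNIV. \<Sum>p\<in>UNIV. \<Sum>l\<in>UNIV. \<Sum>q\<in>UNIV.
        sd_weyl s g W a k b l * ginv g k p * ginv g l q * cnj (sd_weyl s g W m p n q))"

definition bel_robinson_map :: "real \<Rightarrow> real^4^4 \<Rightarrow> real_tensor4 \<Rightarrow> tensor2 \<Rightarrow> tensor2" where
  "bel_robinson_map s g W A =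
     (\<chi> a b. \<Sum>m\<in>UNIV. \<Sum>n\<in>UNIV. raise34 g (bel_robinson s g W) a b m n * A $ m $ n)"

definition bel_robinson_eigenspace ::
  "real \<Rightarrow> real^4^4 \<Rightarrow> real_tensor4 \<Rightarrow> complex \<Rightarrow> tensor2 set" where
  "bel_robinson_eigenspace s g W c =
     {A \<in> traceless_symmetric g. bel_robinson_map s g W A = tscale c A}"

end

theory Submission
  imports Defs
begin

text \<open>
  Write \<open>M\<^sub>i = U\<^sub>i g\<^sup>-\<^sup>1\<close> for the frame. In a tetrad one sees that self-dual bivectors satisfy the Clifford relations
  \<open>M\<^sub>i M\<^sub>j + M\<^sub>j M\<^sub>i = \<delta>\<^sub>i\<^sub>j\<close> and that every \<open>M\<^sub>i\<close> commutes with every conjugate \<open>M\<^sub>j\<close>. Traces of products then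
  vanish by anticommutation, which makes the nine tensors \<open>\<Pi>\<^sub>i\<^sub>j\<close> orthonormal, symmetric and traceless.
  The columns of the self-dual Weyl tensor are self-dual, so it equals \<open>\<Sum>\<^sub>i U\<^sub>i \<otimes> V\<^sub>i\<close> for some bivectors \<open>V\<^sub>i\<close>. The eigenvalue
  equations determine the self-dual part of \<open>V\<^sub>i\<close> to be \<open>- \<rho>\<^sub>i U\<^sub>i\<close>, and the vanishing trace reads
  \<open>- (\<Sum>\<^sub>i \<rho>\<^sub>i) / 2 + \<Sum>\<^sub>i\<^sub>j d\<^sub>i\<^sub>j \<Pi>\<^sub>i\<^sub>j g\<^sup>-\<^sup>1 = 0\<close>, so that both \<open>\<Sum>\<^sub>i \<rho>\<^sub>i\<close> and the anti-self-dual coefficients \<open>d\<^sub>i\<^sub>j\<close> are zero.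
  Since the sum of the eigenvalues and the sum of their squares vanish, they differ by cube roots of unity. Finally
  \<open>T = \<Sum>\<^sub>i\<^sub>j \<rho>\<^sub>i cnj \<rho>\<^sub>j \<Pi>\<^sub>i\<^sub>j \<otimes> \<Pi>\<^sub>i\<^sub>j\<close> with orthonormal \<open>\<Pi>\<^sub>i\<^sub>j\<close> is a spectral decomposition; as the eigenvalue
  is nonzero, an eigentensor is in the span of the image of \<open>T\<close>, so no completeness of the \<open>\<Pi>\<^sub>i\<^sub>j\<close> is needed.
\<close>

section \<open>The Levi-Civita symbol\<close>

lemma UNIV_num4: "(UNIV :: 4 set) = {0, 1, 2, 3}"
proof -
  have "{1, 2, 3, 4::4} = {0, 1, 2, 3}" by auto
  then show ?thesis unfolding UNIV_4 .
qed

lemma sum_num4: "sum f (UNIV :: 4 set) = f 0 + f 1 + f 2 + f 3"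
  unfolding UNIV_num4 by (simp add: ac_simps)

lemma forall_num4: "(\<forall>i::4. P i) \<longleftrightarrow> P 0 \<and> P 1 \<and> P 2 \<and> P 3"
proof -
  have "(\<forall>i. P i) \<longleftrightarrow> (\<forall>i\<in>UNIV. P i)" by simp
  then show ?thesis unfolding UNIV_num4 by simp
qed

text \<open>Follows the branching of \<open>levi_civita\<close>, which thereby becomes the
  determinant of four unit rows; its symmetries are then row operations.\<close>

definition rows4 :: "'a^4 \<Rightarrow> 'a^4 \<Rightarrow> 'a^4 \<Rightarrow> 'a^4 \<Rightarrow> 'a^4^4" where
  "rows4 x y z w = (\<chi> i. if i = 0 then x else if i = 1 then y else if i = 2 then z else w)"

lemma rows4_nth [simp]:
  "rows4 x y z w $ 0 = x" "rows4 x y z w $ 1 = y" "rows4 x y z w $ 2 = z" "rows4 x y z w $ 3 = w"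
  by (simp_all add: rows4_def)

lemma vec_eq_iff4: "(x :: 'a^4) = y \<longleftrightarrow> x $ 0 = y $ 0 \<and> x $ 1 = y $ 1 \<and> x $ 2 = y $ 2 \<and> x $ 3 = y $ 3"
  by (simp add: vec_eq_iff forall_num4)

lemma levi_civita_rows4: "levi_civita a b c d = det (rows4 (axis a 1) (axis b 1) (axis c 1) (axis d 1))"
  unfolding levi_civita_def rows4_def by (rule arg_cong[where f=det]) (simp add: vec_eq_iff)

text \<open>The three adjacent transpositions suffice, since they generate all permutations of the
  rows.\<close>

lemma det_rows4_swap:
  fixes x y z w :: "'a::comm_ring_1^4"
  shows "det (rows4 y x z w) = - det (rows4 x y z w)"
    and "det (rows4 x z y w) = - det (rows4 x y z w)"
    and "det (rows4 x y w z) = - det (rows4 x y z w)"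
proof -
  have *: "det (\<chi> k. A $ Transposition.transpose i j k) = - det A" if "i \<noteq> j" for i j and A :: "'a^4^4"
    using that by (simp add: det_permute_rows permutes_swap_id sign_swap_id)
  have "rows4 y x z w = (\<chi> k. rows4 x y z w $ Transposition.transpose 0 1 k)"
    "rows4 x z y w = (\<chi> k. rows4 x y z w $ Transposition.transpose 1 2 k)"
    "rows4 x y w z = (\<chi> k. rows4 x y z w $ Transposition.transpose 2 3 k)"
    by (simp_all add: vec_eq_iff4[where x="rows4 _ _ _ _"] Transposition.transpose_def)
  then show "det (rows4 y x z w) = - det (rows4 x y z w)"
    "det (rows4 x z y w) = - det (rows4 x y z w)" "det (rows4 x y w z) = - det (rows4 x y z w)"
    by (simp_all add: *)
qed

lemma det_rows4_sum:
  fixes f :: "'b \<Rightarrow> 'a::comm_ring_1^4"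
  assumes "finite S"
  shows "det (rows4 (\<Sum>i\<in>S. c i *s f i) y z w) = (\<Sum>i\<in>S. c i * det (rows4 (f i) y z w))"
proof -
  \<comment> \<open>Keeping the other rows in a \<open>C\<close> free of the summation index gives
    the shape that linearity in a single row expects; the 0 is a placeholder.\<close>
  define C where "C = rows4 0 y z w"
  have r: "rows4 v y z w = (\<chi> i. if i = 0 then v else C $ i)" for v
    by (simp add: C_def vec_eq_iff4[where x="rows4 _ _ _ _"])
  show ?thesis
    unfolding r by (simp add: det_linear_row_sum[OF assms] det_row_mul)
qed

lemma vector_as_axis_sum: "(x :: 'a::comm_ring_1^4) = (\<Sum>a\<in>UNIV. x $ a *s axis a 1)"
  by (simp add: vec_eq_iff axis_def if_distrib cong: if_cong)

text \<open>Multilinearity in the rows: linearity in row 0 is carried to each further row by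
  swapping it with its predecessor.\<close>

lemma det_rows4_expand:
  fixes x y z w :: "real^4"
  shows "det (rows4 x y z w) =
    (\<Sum>a\<in>UNIV. \<Sum>b\<in>UNIV. \<Sum>c\<in>UNIV. \<Sum>d\<in>UNIV. x $ a * y $ b * z $ c * w $ d * levi_civita a b c d)"
proof -
  note sw = det_rows4_swap
  have 1: "det (rows4 x y z w) = (\<Sum>a\<in>UNIV. x $ a * det (rows4 (axis a 1) y z w))" for x y z w :: "real^4"
    by (subst vector_as_axis_sum[of x]) (rule det_rows4_sum, simp)
  have 2: "det (rows4 x y z w) = (\<Sum>a\<in>UNIV. y $ a * det (rows4 x (axis a 1) z w))" for x y z w :: "real^4"
    using 1[of y x z w] by (simp add: sw(1)[of x] sum_negf)
  have 3: "det (rows4 x y z w) = (\<Sum>a\<in>UNIV. z $ a * det (rows4 x y (axis a 1) w))" for x y z w :: "real^4"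
    using 2[of x z y w] by (simp add: sw(2)[of _ y] sum_negf)
  have 4: "det (rows4 x y z w) = (\<Sum>a\<in>UNIV. w $ a * det (rows4 x y z (axis a 1)))" for x y z w :: "real^4"
    using 3[of x y w z] by (simp add: sw(3)[of _ _ z] sum_negf)
  show ?thesis
    unfolding levi_civita_rows4
    by (subst 1, subst 2, subst 3, subst 4) (simp add: sum_distrib_left mult.assoc)
qed

lemma levi_civita_swap:
  "levi_civita b a c d = - levi_civita a b c d"
  "levi_civita a c b d = - levi_civita a b c d"
  "levi_civita a b d c = - levi_civita a b c d"
  unfolding levi_civita_rows4 by (rule det_rows4_swap)+

text \<open>The tensor density law. Both sides are the determinant formed from columns
  \<open>i\<close>, \<open>j\<close>, \<open>k\<close>, \<open>l\<close> of \<open>P\<close>, and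
  the matrix of these columns, taken as rows, factors as \<open>?E ** transpose P\<close>.\<close>

lemma levi_civita_transform:
  fixes P :: "real^4^4"
  shows "(\<Sum>a\<in>UNIV. \<Sum>b\<in>UNIV. \<Sum>c\<in>UNIV. \<Sum>d\<in>UNIV.
      P $ a $ i * P $ b $ j * P $ c $ k * P $ d $ l * levi_civita a b c d) = det P * levi_civita i j k l"
proof -
  let ?E = "rows4 (axis i 1) (axis j 1) (axis k 1) (axis l 1) :: real^4^4"
  have "\<forall>m. rows4 (column i P) (column j P) (column k P) (column l P) $ m = (?E ** transpose P) $ m"
    unfolding forall_num4
    by (simp add: vec_eq_iff matrix_matrix_mult_def column_def transpose_def axis_def if_distrib if_distribR
      cong: if_cong)
  then have "rows4 (column i P) (column j P) (column k P) (column l P) = ?E ** transpose P"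
    by (subst vec_eq_iff)
  then have "det (rows4 (column i P) (column j P) (column k P) (column l P)) = det P * levi_civita i j k l"
    by (simp add: det_mul levi_civita_rows4)
  then show ?thesis
    by (simp add: det_rows4_expand column_def)
qed

lemma levi_civita_repeated [simp]:
  "levi_civita a a c d = 0" "levi_civita a b a d = 0" "levi_civita a b c a = 0"
  "levi_civita a b b d = 0" "levi_civita a b c b = 0" "levi_civita a b c c = 0"
proof -
  show 1: "levi_civita a a c d = 0" for a c d
    using levi_civita_swap(1)[of a a c d] by simp
  show 2: "levi_civita a b b d = 0" for a b d
    using levi_civita_swap(2)[of a b b d] by simp
  show 3: "levi_civita a b c c = 0" for a b c
    using levi_civita_swap(3)[of a b c c] by simp
  show 4: "levi_civita a b a d = 0" for a b d
    using levi_civita_swap(2)[of a b a d] 1 by simp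
  show 5: "levi_civita a b c b = 0" for a b c
    using levi_civita_swap(3)[of a b c b] 2 by simp
  show "levi_civita a b c a = 0"
    using levi_civita_swap(3)[of a b c a] 4 by simp
qed

lemma levi_civita_0123: "levi_civita 0 1 2 3 = 1"
proof -
  have "\<forall>m. rows4 (axis 0 1) (axis 1 1) (axis 2 1) (axis 3 1) $ m = (mat 1 :: real^4^4) $ m"
    unfolding forall_num4 by (simp add: vec_eq_iff mat_def axis_def)
  then have "rows4 (axis 0 1) (axis 1 1) (axis 2 1) (axis 3 1) = (mat 1 :: real^4^4)"
    by (subst vec_eq_iff)
  then show ?thesis by (simp add: levi_civita_rows4)
qed

lemma levi_civita_values [simp]:
  "levi_civita 0 1 2 3 = 1" "levi_civita 0 1 3 2 = - 1"
  "levi_civita 0 2 1 3 = - 1" "levi_civita 0 2 3 1 = 1"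
  "levi_civita 0 3 1 2 = 1" "levi_civita 0 3 2 1 = - 1"
  "levi_civita 1 2 0 3 = 1" "levi_civita 1 2 3 0 = - 1"
  "levi_civita 1 3 0 2 = - 1" "levi_civita 1 3 2 0 = 1"
  "levi_civita 2 3 0 1 = 1" "levi_civita 2 3 1 0 = - 1"
  "levi_civita 1 0 2 3 = - 1" "levi_civita 1 0 3 2 = 1"
  "levi_civita 2 0 1 3 = 1" "levi_civita 2 0 3 1 = - 1"
  "levi_civita 3 0 1 2 = - 1" "levi_civita 3 0 2 1 = 1"
  "levi_civita 2 1 0 3 = - 1" "levi_civita 2 1 3 0 = 1"
  "levi_civita 3 1 0 2 = 1" "levi_civita 3 1 2 0 = - 1"
  "levi_civita 3 2 0 1 = - 1" "levi_civita 3 2 1 0 = 1"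
proof -
  note L = levi_civita_0123 levi_civita_swap
  show a: "levi_civita 0 1 2 3 = 1" by (rule L)
  show b: "levi_civita 0 1 3 2 = - 1" using L(4)[of 0 1 3 2] a by simp
  show c: "levi_civita 0 2 1 3 = - 1" using L(3)[of 0 2 1 3] a by simp
  show d: "levi_civita 0 2 3 1 = 1" using L(4)[of 0 2 3 1] c by simp
  show e: "levi_civita 0 3 1 2 = 1" using L(3)[of 0 3 1 2] b by simp
  show f: "levi_civita 0 3 2 1 = - 1" using L(4)[of 0 3 2 1] e by simp
  show a': "levi_civita 1 0 2 3 = - 1" using L(2)[of 1 0 2 3] a by simp
  show b': "levi_civita 1 0 3 2 = 1" using L(2)[of 1 0 3 2] b by simp
  show c': "levi_civita 2 0 1 3 = 1" using L(2)[of 2 0 1 3] c by simp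
  show d': "levi_civita 2 0 3 1 = - 1" using L(2)[of 2 0 3 1] d by simp
  show e': "levi_civita 3 0 1 2 = - 1" using L(2)[of 3 0 1 2] e by simp
  show f': "levi_civita 3 0 2 1 = 1" using L(2)[of 3 0 2 1] f by simp
  show a2: "levi_civita 1 2 0 3 = 1" using L(3)[of 1 2 0 3] a' by simp
  show b2: "levi_civita 1 3 0 2 = - 1" using L(3)[of 1 3 0 2] b' by simp
  show c2: "levi_civita 2 1 0 3 = - 1" using L(3)[of 2 1 0 3] c' by simp
  show d2: "levi_civita 2 3 0 1 = 1" using L(3)[of 2 3 0 1] d' by simp
  show e2: "levi_civita 3 1 0 2 = 1" using L(3)[of 3 1 0 2] e' by simp
  show f2: "levi_civita 3 2 0 1 = - 1" using L(3)[of 3 2 0 1] f' by simp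
  show "levi_civita 1 2 3 0 = - 1" using L(4)[of 1 2 3 0] a2 by simp
  show "levi_civita 1 3 2 0 = 1" using L(4)[of 1 3 2 0] b2 by simp
  show "levi_civita 2 1 3 0 = 1" using L(4)[of 2 1 3 0] c2 by simp
  show "levi_civita 2 3 1 0 = - 1" using L(4)[of 2 3 1 0] d2 by simp
  show "levi_civita 3 1 2 0 = - 1" using L(4)[of 3 1 2 0] e2 by simp
  show "levi_civita 3 2 1 0 = 1" using L(4)[of 3 2 1 0] f2 by simp
qed

section \<open>Pulling the dual back along a tetrad\<close>

definition minkowski :: "real^4^4" where
  "minkowski = (\<chi> a b. if a = b then if a = 0 then - 1 else 1 else 0)"

definition complexify :: "real^4^4 \<Rightarrow> complex^4^4" where
  "complexify A = (\<chi> a b. complex_of_real (A $ a $ b))"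

definition inverse_metric :: "real^4^4 \<Rightarrow> complex^4^4" where
  "inverse_metric g = complexify (matrix_inv g)"

lemma inverse_metric_nth [simp]: "inverse_metric g $ a $ b = ginv g a b"
  by (simp add: inverse_metric_def complexify_def ginv_def)

lemma complexify_mult: "complexify (A ** B) = complexify A ** complexify B"
  by (simp add: complexify_def matrix_matrix_mult_def vec_eq_iff)

lemma complexify_transpose: "complexify (transpose A) = transpose (complexify A)"
  by (simp add: complexify_def transpose_def vec_eq_iff)

lemma complexify_mat1 [simp]: "complexify (mat 1) = mat 1"
  by (simp add: complexify_def mat_def vec_eq_iff)

lemma matrix_inv_eqI:
  fixes A :: "'a::field^'n^'n"
  assumes "A ** B = mat 1"
  shows "matrix_inv A = B"
proof -
  have *: "B ** A = mat 1" using assms matrix_left_right_inverse by blast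
  then have "A ** matrix_inv A = mat 1"
    unfolding matrix_inv_def using assms by (metis (mono_tags, lifting) someI)
  then show ?thesis
    by (metis * matrix_mul_assoc matrix_mul_lid matrix_mul_rid)
qed

lemma minkowski_values:
  "minkowski $ 0 $ 0 = - 1" "minkowski $ 1 $ 1 = 1" "minkowski $ 2 $ 2 = 1" "minkowski $ 3 $ 3 = 1"
  "a \<noteq> b \<Longrightarrow> minkowski $ a $ b = 0"
  by (simp_all add: minkowski_def)

lemma minkowski_sq: "minkowski ** minkowski = mat 1"
  unfolding vec_eq_iff forall_num4 by (simp add: matrix_matrix_mult_def mat_def sum_num4 minkowski_values)

lemma matrix_inv_minkowski [simp]: "matrix_inv minkowski = minkowski"
  by (rule matrix_inv_eqI) (rule minkowski_sq)

lemma transpose_minkowski: "transpose minkowski = minkowski"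
  by (simp add: minkowski_def transpose_def vec_eq_iff)

lemma abs_det_minkowski: "\<bar>det minkowski\<bar> = 1"
proof -
  have "det minkowski * det minkowski = 1"
    by (simp flip: det_mul add: minkowski_sq)
  then show ?thesis
    by (simp flip: abs_square_eq_1 add: power2_eq_square)
qed

text \<open>The columns of \<open>P\<close> form an orthonormal tetrad. The determinant relation is
  what makes the density factor of the volume element cancel up to a sign.\<close>

lemma lorentzian_tetrad:
  assumes "lorentzian g"
  obtains P where "invertible P" "transpose P ** g ** P = minkowski"
    "matrix_inv g = P ** minkowski ** transpose P" "\<bar>det g\<bar> * (det P)\<^sup>2 = 1"
proof -
  obtain P where P: "invertible P" "transpose P ** g ** P = minkowski"
    using assms unfolding lorentzian_def minkowski_def by blast
  obtain Q where Q: "P ** Q = mat 1" "Q ** P = mat 1"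
    using P(1) unfolding invertible_def by blast
  have QP: "transpose Q ** transpose P = mat 1"
    using Q(1) by (metis matrix_transpose_mul transpose_mat)
  \<comment> \<open>The prefix \<open>transpose P\<close> lets \<open>P(2)\<close> apply to the
    candidate inverse; \<open>transpose Q\<close> removes it afterwards.\<close>
  have "transpose P ** (g ** (P ** minkowski ** transpose P)) = minkowski ** minkowski ** transpose P"
    by (simp add: P(2) matrix_mul_assoc)
  also have "\<dots> = transpose P"
    by (simp add: minkowski_sq)
  finally have "transpose Q ** transpose P ** (g ** (P ** minkowski ** transpose P)) = transpose Q ** transpose P"
    by (metis matrix_mul_assoc)
  then have inv: "matrix_inv g = P ** minkowski ** transpose P"
    by (intro matrix_inv_eqI) (simp add: QP)
  have "det P * det g * det P = det minkowski"
    by (simp flip: P(2) add: det_mul)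
  then have "\<bar>det P * det g * det P\<bar> = 1"
    by (simp add: abs_det_minkowski)
  then have "\<bar>det g\<bar> * (det P)\<^sup>2 = 1"
    by (simp add: abs_mult power2_eq_square ac_simps)
  with that[OF P inv] show thesis by blast
qed

lemma raise2_eq: "raise2 g A = inverse_metric g ** A ** transpose (inverse_metric g)"
proof -
  have "(\<Sum>k\<in>UNIV. \<Sum>l\<in>UNIV. ginv g m k * ginv g n l * A $ k $ l) =
     (\<Sum>l\<in>UNIV. (\<Sum>k\<in>UNIV. ginv g m k * A $ k $ l) * ginv g n l)" for m n
    by (subst sum.swap) (simp add: sum_distrib_left sum_distrib_right ac_simps)
  then show ?thesis
    by (simp add: raise2_def vec_eq_iff matrix_matrix_mult_def transpose_def)
qed

lemma tprod_eq: "tprod g A B = A ** inverse_metric g ** B"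
  unfolding tprod_def matrix_matrix_mult_def vec_eq_iff
  by (simp add: sum_distrib_right)

lemma sum_rotate:
  "(\<Sum>b\<in>B. \<Sum>c\<in>C. \<Sum>d\<in>D. f b c d) = (\<Sum>c\<in>C. \<Sum>d\<in>D. \<Sum>b\<in>B. f b c d)"
  by (rule trans[OF sum.swap]) (intro sum.cong refl sum.swap)

lemma sum_swap_pairs:
  "(\<Sum>a\<in>A. \<Sum>b\<in>B. \<Sum>c\<in>C. \<Sum>d\<in>D. f a b c d) = (\<Sum>c\<in>C. \<Sum>d\<in>D. \<Sum>a\<in>A. \<Sum>b\<in>B. f a b c d)"
  by (subst sum_rotate) (rule sum_rotate)

text \<open>The components of a covariant 2-tensor in the basis given by the columns of
  \<open>P\<close>.\<close>

definition pull_back :: "real^4^4 \<Rightarrow> tensor2 \<Rightarrow> tensor2" where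
  "pull_back P F = transpose (complexify P) ** F ** complexify P"

lemma matrix_mult_both_nth:
  fixes A B :: "complex^4^4"
  shows "(A ** F ** B) $ i $ j = (\<Sum>a\<in>UNIV. \<Sum>b\<in>UNIV. A $ i $ a * B $ b $ j * F $ a $ b)"
  unfolding matrix_matrix_mult_def
  by simp (subst sum.swap, simp add: sum_distrib_left sum_distrib_right ac_simps)

text \<open>The dual is natural because the volume element is a tensor. The tetrad may reverse the
  orientation of the basis, hence the factor \<open>sgn (det P)\<close>.\<close>

lemma star2_transform:
  assumes det: "\<bar>det g\<bar> * (det P)\<^sup>2 = 1" and inv: "matrix_inv g = P ** minkowski ** transpose P"
  shows "pull_back P (star2 s g F) = star2 (s * sgn (det P)) minkowski (pull_back P F)"
proof -
  define C where "C = complexify P"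
  define R where "R = raise2 minkowski (pull_back P F)"
  define k where "k = s * sqrt \<bar>det g\<bar>"
  have N: "inverse_metric g = C ** complexify minkowski ** transpose C"
    by (simp add: inverse_metric_def inv complexify_mult complexify_transpose C_def)
  have R: "raise2 g F = C ** R ** transpose C"
    unfolding raise2_eq R_def N pull_back_def C_def[symmetric] 
    by (simp add: inverse_metric_def matrix_transpose_mul matrix_mul_assoc)
  have d0: "det P \<noteq> 0" using det by auto
  have "(sqrt \<bar>det g\<bar> * \<bar>det P\<bar>)\<^sup>2 = 1"
    using det by (simp add: power_mult_distrib)
  then have "sqrt \<bar>det g\<bar> * \<bar>det P\<bar> = 1"
    by (simp add: abs_square_eq_1 abs_mult)
  then have sg: "sqrt \<bar>det g\<bar> * det P = sgn (det P)"
    by (cases "det P > 0") (use d0 in \<open>auto simp: sgn_if\<close>)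
  have cC: "C $ a $ b = complex_of_real (P $ a $ b)" for a b
    by (simp add: C_def complexify_def)
  have "pull_back P (star2 s g F) $ i $ j = star2 (s * sgn (det P)) minkowski (pull_back P F) $ i $ j" for i j
  proof -
    have "pull_back P (star2 s g F) $ i $ j =
      (\<Sum>a\<in>UNIV. \<Sum>b\<in>UNIV. C $ a $ i * C $ b $ j * (1/2 * (\<Sum>m\<in>UNIV. \<Sum>n\<in>UNIV.
         complex_of_real (volume_element s g a b m n) * (\<Sum>k\<in>UNIV. \<Sum>l\<in>UNIV. C $ m $ k * C $ n $ l * R $ k $ l))))"
      unfolding pull_back_def matrix_mult_both_nth C_def[symmetric]
      by (simp add: star2_def R matrix_mult_both_nth transpose_def)
    also have "\<dots> = (\<Sum>a\<in>UNIV. \<Sum>b\<in>UNIV. \<Sum>m\<in>UNIV. \<Sum>n\<in>UNIV. \<Sum>k\<in>UNIV. \<Sum>l\<in>UNIV.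
         C $ a $ i * C $ b $ j * (1/2 * (complex_of_real (volume_element s g a b m n) * (C $ m $ k * C $ n $ l * R $ k $ l))))"
      by (simp only: sum_distrib_left)
    \<comment> \<open>With the tetrad indices \<open>k\<close>, \<open>l\<close> outermost, the four
      factors of \<open>P\<close> contract the Levi-Civita symbol.\<close>
    also have "\<dots> = (\<Sum>k\<in>UNIV. \<Sum>l\<in>UNIV. \<Sum>a\<in>UNIV. \<Sum>b\<in>UNIV. \<Sum>m\<in>UNIV. \<Sum>n\<in>UNIV.
         C $ a $ i * C $ b $ j * (1/2 * (complex_of_real (volume_element s g a b m n) * (C $ m $ k * C $ n $ l * R $ k $ l))))"
      by (rule trans[OF _ sum_swap_pairs]) (intro sum.cong refl sum_swap_pairs)
    also have "\<dots> = (\<Sum>k'\<in>UNIV. \<Sum>l\<in>UNIV. 1/2 * complex_of_real (k * (\<Sum>a\<in>UNIV. \<Sum>b\<in>UNIV. \<Sum>m\<in>UNIV. \<Sum>n\<in>UNIV.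
         P $ a $ i * P $ b $ j * P $ m $ k' * P $ n $ l * levi_civita a b m n)) * R $ k' $ l)"
      by (simp add: sum_distrib_left sum_distrib_right cC volume_element_def k_def mult_ac)
    also have "\<dots> = (\<Sum>k'\<in>UNIV. \<Sum>l\<in>UNIV. 1/2 * complex_of_real (s * sgn (det P) * levi_civita i j k' l) * R $ k' $ l)"
      unfolding levi_civita_transform by (simp add: k_def sg mult.assoc flip: sg)
    also have "\<dots> = star2 (s * sgn (det P)) minkowski (pull_back P F) $ i $ j"
      by (simp add: star2_def R_def volume_element_def abs_det_minkowski sum_distrib_left mult.assoc)
    finally show ?thesis .
  qed
  then show ?thesis by (simp add: vec_eq_iff)
qed

section \<open>Self-dual bivectors in Minkowski space\<close>

lemma complexify_nth [simp]: "complexify A $ a $ b = complex_of_real (A $ a $ b)"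
  by (simp add: complexify_def)

lemma tscale_nth [simp]: "tscale c A $ a $ b = c * A $ a $ b"
  by (simp add: tscale_def)

lemma tconj_nth [simp]: "tconj A $ a $ b = cnj (A $ a $ b)"
  by (simp add: tconj_def)

lemma tscale_mult [simp]: "tscale c A ** B = tscale c (A ** B)" "A ** tscale c B = tscale c (A ** B)"
  by (simp_all add: matrix_matrix_mult_def vec_eq_iff sum_distrib_left mult_ac)

lemma transpose_tscale [simp]: "transpose (tscale c A) = tscale c (transpose A)"
  by (simp add: transpose_def vec_eq_iff)

lemma transpose_uminus: "transpose (- A :: 'a::ab_group_add^'n^'m) = - transpose A"
  by (simp add: transpose_def vec_eq_iff)

lemma transpose_add: "transpose (A + B :: 'a::ab_group_add^'n^'m) = transpose A + transpose B"
  by (simp add: transpose_def vec_eq_iff)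

lemma matrix_mult_uminus [simp]:
  "(- A) ** B = - (A ** B :: complex^4^4)" "A ** (- B) = - (A ** B :: complex^4^4)"
  by (simp_all add: matrix_matrix_mult_def vec_eq_iff sum_negf)

lemma tconj_mult: "tconj (A ** B) = tconj A ** tconj B"
  by (simp add: matrix_matrix_mult_def vec_eq_iff)

lemma tconj_complexify [simp]: "tconj (complexify A) = complexify A"
  by (simp add: complexify_def vec_eq_iff)

lemma tconj_transpose: "tconj (transpose A) = transpose (tconj A)"
  by (simp add: transpose_def vec_eq_iff)

lemma tconj_tconj [simp]: "tconj (tconj A) = A"
  by (simp add: vec_eq_iff)

lemma tconj_tscale: "tconj (tscale c A) = tscale (cnj c) (tconj A)"
  by (simp add: vec_eq_iff)

lemma antisymmetric_nth:
  fixes F :: "complex^4^4"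
  assumes "transpose F = - F"
  shows "F $ b $ a = - F $ a $ b"
  using arg_cong[OF assms, of "\<lambda>A. A $ a $ b"] by (simp add: transpose_def)

lemma antisymmetric_diag:
  fixes F :: "complex^4^4"
  assumes "transpose F = - F"
  shows "F $ a $ a = 0"
  using antisymmetric_nth[OF assms, of a a] by simp

lemma antisymmetricI:
  fixes F :: "complex^4^4"
  assumes "\<And>a b. F $ b $ a = - F $ a $ b"
  shows "transpose F = - F"
proof -
  have "transpose F $ a $ b = (- F) $ a $ b" for a b
    using assms[where a=a and b=b] by (simp add: transpose_def)
  then show ?thesis unfolding vec_eq_iff by blast
qed

lemma transpose_star2: "transpose (star2 s g F) = - star2 s g F"
proof -
  have "star2 s g F $ b $ a = - star2 s g F $ a $ b" for a b
  proof -
    have "volume_element s g b a m n = - volume_element s g a b m n" for m n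
      by (simp add: volume_element_def levi_civita_swap(1)[of b a])
    then show ?thesis
      by (simp add: star2_def sum_negf)
  qed
  then show ?thesis by (rule antisymmetricI)
qed

lemma raise2_minkowski: 
  "raise2 minkowski F $ m $ n = complex_of_real (minkowski $ m $ m * minkowski $ n $ n) * F $ m $ n"
proof -
  have *: "ginv minkowski a b = (if b = a then complex_of_real (minkowski $ a $ a) else 0)" for a b
    unfolding ginv_def matrix_inv_minkowski by (simp add: minkowski_def)
  have "ginv minkowski m k * ginv minkowski n l * F $ k $ l =
      (if l = n then if k = m then complex_of_real (minkowski $ m $ m * minkowski $ n $ n) * F $ m $ n else 0 else 0)" for k l
    by (simp add: *)
  then show ?thesis
    by (simp add: raise2_def)
qed

text \<open>The dual exchanges electric and magnetic components; the sign difference between the two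
  directions makes its square minus the identity.\<close>

lemma star2_minkowski:
  assumes "transpose F = - F"
  shows "star2 s minkowski F $ 0 $ 1 = complex_of_real s * F $ 2 $ 3" "star2 s minkowski F $ 0 $ 2 = - complex_of_real s * F $ 1 $ 3"
    "star2 s minkowski F $ 0 $ 3 = complex_of_real s * F $ 1 $ 2" "star2 s minkowski F $ 2 $ 3 = - complex_of_real s * F $ 0 $ 1"
    "star2 s minkowski F $ 1 $ 3 = complex_of_real s * F $ 0 $ 2" "star2 s minkowski F $ 1 $ 2 = - complex_of_real s * F $ 0 $ 3"
proof -
  note a = antisymmetric_nth[OF assms]
  note * = a[of 1 0] a[of 2 0] a[of 3 0] a[of 2 1] a[of 3 1] a[of 3 2]
  show "star2 s minkowski F $ 0 $ 1 = complex_of_real s * F $ 2 $ 3" "star2 s minkowski F $ 0 $ 2 = - complex_of_real s * F $ 1 $ 3"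
    "star2 s minkowski F $ 0 $ 3 = complex_of_real s * F $ 1 $ 2" "star2 s minkowski F $ 2 $ 3 = - complex_of_real s * F $ 0 $ 1"
    "star2 s minkowski F $ 1 $ 3 = complex_of_real s * F $ 0 $ 2" "star2 s minkowski F $ 1 $ 2 = - complex_of_real s * F $ 0 $ 3"
    unfolding star2_def
    by (simp_all add: sum_num4 raise2_minkowski minkowski_values volume_element_def abs_det_minkowski *)
qed

lemma antisymmetric_eqI:
  fixes F H :: "complex^4^4"
  assumes "transpose F = - F" "transpose H = - H"
    and "F $ 0 $ 1 = H $ 0 $ 1" "F $ 0 $ 2 = H $ 0 $ 2" "F $ 0 $ 3 = H $ 0 $ 3"
    and "F $ 2 $ 3 = H $ 2 $ 3" "F $ 1 $ 3 = H $ 1 $ 3" "F $ 1 $ 2 = H $ 1 $ 2"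
  shows "F = H"
proof -
  have "F $ 1 $ 0 = H $ 1 $ 0" "F $ 2 $ 0 = H $ 2 $ 0" "F $ 3 $ 0 = H $ 3 $ 0"
    "F $ 3 $ 2 = H $ 3 $ 2" "F $ 3 $ 1 = H $ 3 $ 1" "F $ 2 $ 1 = H $ 2 $ 1"
    using assms antisymmetric_nth[OF assms(1)] antisymmetric_nth[OF assms(2)] by metis+
  then show ?thesis
    unfolding vec_eq_iff forall_num4 using assms antisymmetric_diag[OF assms(1)] antisymmetric_diag[OF assms(2)]
    by simp
qed

lemma star2_star2_minkowski:
  assumes "s = 1 \<or> s = - 1" "transpose F = - F"
  shows "star2 s minkowski (star2 s minkowski F) = - F"
  by (rule antisymmetric_eqI)
    (use assms in \<open>auto simp: star2_minkowski transpose_star2 transpose_uminus\<close>)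

text \<open>A self-dual bivector amounts to a complex 3-vector, its electric part in row 0. Products
  of such bivectors can then be checked entry by entry.\<close>

lemma self_dual_minkowski_values:
  assumes s: "s = 1 \<or> s = - 1" and F: "F \<in> self_dual_bivectors s minkowski"
  shows "F $ 2 $ 3 = \<i> * complex_of_real s * F $ 0 $ 1" "F $ 1 $ 3 = - \<i> * complex_of_real s * F $ 0 $ 2" "F $ 1 $ 2 = \<i> * complex_of_real s * F $ 0 $ 3"
    "F $ 3 $ 2 = - \<i> * complex_of_real s * F $ 0 $ 1" "F $ 3 $ 1 = \<i> * complex_of_real s * F $ 0 $ 2" "F $ 2 $ 1 = - \<i> * complex_of_real s * F $ 0 $ 3"
    "F $ 1 $ 0 = - F $ 0 $ 1" "F $ 2 $ 0 = - F $ 0 $ 2" "F $ 3 $ 0 = - F $ 0 $ 3" "F $ a $ a = 0"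
proof -
  have t: "transpose F = - F" and e: "star2 s minkowski F $ a $ b = \<i> * F $ a $ b" for a b
    using F by (simp_all add: self_dual_bivectors_def)
  note anti = antisymmetric_nth[OF t]
  show a: "F $ 2 $ 3 = \<i> * complex_of_real s * F $ 0 $ 1" "F $ 1 $ 3 = - \<i> * complex_of_real s * F $ 0 $ 2" "F $ 1 $ 2 = \<i> * complex_of_real s * F $ 0 $ 3"
    using e[of 0 1] e[of 0 2] e[of 0 3] s unfolding star2_minkowski[OF t]
    by (auto simp: minus_equation_iff[of "F $ _ $ _"])
  show "F $ 1 $ 0 = - F $ 0 $ 1" "F $ 2 $ 0 = - F $ 0 $ 2" "F $ 3 $ 0 = - F $ 0 $ 3"
    by (rule anti)+
  show "F $ a $ a = 0" by (rule antisymmetric_diag[OF t])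
  show "F $ 3 $ 2 = - \<i> * complex_of_real s * F $ 0 $ 1" "F $ 3 $ 1 = \<i> * complex_of_real s * F $ 0 $ 2" "F $ 2 $ 1 = - \<i> * complex_of_real s * F $ 0 $ 3"
    using a anti[of 3 2] anti[of 3 1] anti[of 2 1] by simp_all
qed

lemma minkowski_mult_nth:
  "(F ** complexify minkowski ** H) $ a $ b =
    - F $ a $ 0 * H $ 0 $ b + F $ a $ 1 * H $ 1 $ b + F $ a $ 2 * H $ 2 $ b + F $ a $ 3 * H $ 3 $ b"
  by (simp add: matrix_matrix_mult_def sum_num4 complexify_def minkowski_values)

text \<open>The symmetrised product is twice the dot product of the electric parts. The constant
  stays existential, because its invariant value is later read off from a trace.\<close>

lemma self_dual_anticommute_minkowski:
  assumes s: "s = 1 \<or> s = - 1"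
    and F: "F \<in> self_dual_bivectors s minkowski" and H: "H \<in> self_dual_bivectors s minkowski"
  shows "\<exists>c. F ** complexify minkowski ** H + H ** complexify minkowski ** F = tscale c (complexify minkowski)"
proof -
  have ss: "complex_of_real s * (complex_of_real s * z) = z" for z
    using s by auto
  note v = self_dual_minkowski_values[OF s F] self_dual_minkowski_values[OF s H]
  have "F ** complexify minkowski ** H + H ** complexify minkowski ** F =
     tscale (2 * (F $ 0 $ 1 * H $ 0 $ 1 + F $ 0 $ 2 * H $ 0 $ 2 + F $ 0 $ 3 * H $ 0 $ 3)) (complexify minkowski)"
    unfolding vec_eq_iff forall_num4
    by (simp add: minkowski_mult_nth v minkowski_values algebra_simps ss)
  then show ?thesis by blast
qed

text \<open>Conjugates of self-dual bivectors are anti-self-dual, and the two kinds generate the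
  commuting ideals of the complexified Lorentz algebra.\<close>

lemma self_dual_conj_commute_minkowski:
  assumes s: "s = 1 \<or> s = - 1"
    and F: "F \<in> self_dual_bivectors s minkowski" and H: "H \<in> self_dual_bivectors s minkowski"
  shows "F ** complexify minkowski ** tconj H = tconj H ** complexify minkowski ** F"
proof -
  have ss: "complex_of_real s * (complex_of_real s * z) = z" for z
    using s by auto
  note v = self_dual_minkowski_values[OF s F] self_dual_minkowski_values[OF s H]
  show ?thesis
    unfolding vec_eq_iff forall_num4
    by (simp add: minkowski_mult_nth v minkowski_values algebra_simps ss)
qed

section \<open>Self-dual bivectors of a Lorentzian metric\<close>

lemma matrix_add_rdistrib: "(A + B) ** C = A ** C + B ** (C :: complex^4^4)"
  by (simp add: matrix_matrix_mult_def vec_eq_iff distrib_right sum.distrib)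

lemma tconj_add: "tconj (A + B) = tconj A + tconj B"
  by (simp add: vec_eq_iff)

text \<open>Collects what transfers an identity from Minkowski space to \<open>g\<close>: congruence
  by an invertible matrix turns the metric, its inverse and the dual into the standard ones, with
  orientation \<open>s'\<close>.\<close>

lemma complex_tetrad:
  assumes "lorentzian g" and s: "s = 1 \<or> s = - 1"
  obtains P D s' where "complexify P ** D = mat 1" "D ** complexify P = mat 1" "s' = 1 \<or> s' = (- 1 :: real)"
    "inverse_metric g = complexify P ** complexify minkowski ** transpose (complexify P)"
    "pull_back P (complexify g) = complexify minkowski"
    "\<And>F. pull_back P (star2 s g F) = star2 s' minkowski (pull_back P F)"
proof -
  obtain P where P: "invertible P" "transpose P ** g ** P = minkowski"
    "matrix_inv g = P ** minkowski ** transpose P" "\<bar>det g\<bar> * (det P)\<^sup>2 = 1"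
    using lorentzian_tetrad[OF assms(1)] by blast
  obtain Q where Q: "P ** Q = mat 1" "Q ** P = mat 1"
    using P(1) unfolding invertible_def by blast
  have "det P \<noteq> 0" using P(4) by auto
  then have s': "s * sgn (det P) = 1 \<or> s * sgn (det P) = - 1"
    using s by (auto simp: sgn_if)
  have 1: "complexify P ** complexify Q = mat 1" "complexify Q ** complexify P = mat 1"
    by (simp_all flip: complexify_mult add: Q)
  have 2: "inverse_metric g = complexify P ** complexify minkowski ** transpose (complexify P)"
    by (simp add: inverse_metric_def P(3) complexify_mult complexify_transpose)
  have 3: "pull_back P (complexify g) = complexify minkowski"
    by (simp flip: P(2) add: pull_back_def complexify_mult complexify_transpose)
  show thesis
    by (rule that[OF 1 s' 2 3]) (rule star2_transform[OF P(4,3)])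
qed

text \<open>Congruence by \<open>D\<close> undoes the pull-back, so a tensor identity for
  \<open>g\<close> may be verified in the tetrad.\<close>

lemma pull_back_inj:
  assumes D: "complexify P ** D = mat 1" and "pull_back P A = pull_back P B"
  shows "A = B"
proof -
  have t: "transpose D ** transpose (complexify P) = mat 1"
    using D by (metis matrix_transpose_mul transpose_mat)
  have *: "transpose D ** pull_back P A ** D = A" for A
  proof -
    have "transpose D ** pull_back P A ** D = (transpose D ** transpose (complexify P)) ** A ** (complexify P ** D)"
      by (simp add: pull_back_def matrix_mul_assoc)
    then show ?thesis by (simp add: t D)
  qed
  show ?thesis by (metis * assms(2))
qed

lemma pull_back_linear:
  "pull_back P (A + B) = pull_back P A + pull_back P B" "pull_back P (tscale c A) = tscale c (pull_back P A)"
  "pull_back P (- A) = - pull_back P A" "pull_back P (tconj A) = tconj (pull_back P A)"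
  "transpose (pull_back P A) = pull_back P (transpose A)"
  by (simp_all add: pull_back_def matrix_add_ldistrib matrix_add_rdistrib tconj_mult tconj_transpose
      matrix_transpose_mul matrix_mul_assoc)

lemma pull_back_mult:
  assumes "inverse_metric g = complexify P ** complexify minkowski ** transpose (complexify P)"
  shows "pull_back P (F ** inverse_metric g ** H) = pull_back P F ** complexify minkowski ** pull_back P H"
  by (simp add: pull_back_def assms matrix_mul_assoc)

lemma pull_back_self_dual:
  assumes "\<And>F. pull_back P (star2 s g F) = star2 s' minkowski (pull_back P F)"
    and "F \<in> self_dual_bivectors s g"
  shows "pull_back P F \<in> self_dual_bivectors s' minkowski"
  using assms by (simp add: self_dual_bivectors_def pull_back_linear flip: assms(1))

lemma transpose_inverse_metric:
  assumes "lorentzian g"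
  shows "transpose (inverse_metric g) = inverse_metric g"
proof -
  obtain P where "inverse_metric g = complexify P ** complexify minkowski ** transpose (complexify P)"
    using complex_tetrad[OF assms, of 1] by metis
  then show ?thesis
    by (simp add: matrix_transpose_mul matrix_mul_assoc transpose_minkowski flip: complexify_transpose)
qed

lemma inverse_metric_left_inverse:
  assumes "lorentzian g"
  shows "complexify g ** inverse_metric g = mat 1"
proof -
  obtain P :: "real^4^4" where P: "\<bar>det g\<bar> * (det P)\<^sup>2 = 1"
    using lorentzian_tetrad[OF assms] by blast
  then have "det g \<noteq> 0" by auto
  then have "invertible g" by (simp add: invertible_det_nz)
  then obtain h where h: "g ** h = mat 1" by (auto simp: invertible_def)
  then have "matrix_inv g = h" by (rule matrix_inv_eqI)
  then show ?thesis using h by (simp add: inverse_metric_def flip: complexify_mult)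
qed

lemma star2_star2:
  assumes "lorentzian g" "s = 1 \<or> s = - 1" "transpose F = - F"
  shows "star2 s g (star2 s g F) = - F"
proof -
  obtain P D s' where P: "complexify P ** D = mat 1" "s' = 1 \<or> s' = (- 1 :: real)"
    "\<And>F. pull_back P (star2 s g F) = star2 s' minkowski (pull_back P F)"
    using complex_tetrad[OF assms(1,2)] by metis
  show ?thesis
    by (rule pull_back_inj[OF P(1)])
      (simp add: P(3) pull_back_linear star2_star2_minkowski[OF P(2)] assms(3))
qed

lemma self_dual_conj_commute:
  assumes "lorentzian g" "s = 1 \<or> s = - 1"
    and F: "F \<in> self_dual_bivectors s g" and H: "H \<in> self_dual_bivectors s g"
  shows "F ** inverse_metric g ** tconj H = tconj H ** inverse_metric g ** F"
proof -
  obtain P D s' where P: "complexify P ** D = mat 1" "s' = 1 \<or> s' = (- 1 :: real)"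
    "inverse_metric g = complexify P ** complexify minkowski ** transpose (complexify P)"
    "\<And>F. pull_back P (star2 s g F) = star2 s' minkowski (pull_back P F)"
    using complex_tetrad[OF assms(1,2)] by metis
  note sd = pull_back_self_dual[OF P(4)]
  show ?thesis
    by (rule pull_back_inj[OF P(1)])
      (simp only: pull_back_mult[OF P(3)] pull_back_linear
        self_dual_conj_commute_minkowski[OF P(2) sd[OF F] sd[OF H]])
qed

lemma trace_tscale: "trace (tscale c A) = c * trace A"
  by (simp add: trace_def sum_distrib_left)

lemma bivector_metric_eq:
  "bivector_metric g F H = 1/2 * trace (F ** transpose (raise2 g H))"
  by (simp add: bivector_metric_def trace_def matrix_matrix_mult_def transpose_def)

text \<open>The transferred relation gives a multiple of \<open>g\<close>, hence of the identity
  after multiplication by \<open>N\<close>. Taking traces, with \<open>trace (mat 1) = 4\<close>,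
  identifies the factor.\<close>

lemma self_dual_anticommute:
  assumes "lorentzian g" "s = 1 \<or> s = - 1"
    and F: "F \<in> self_dual_bivectors s g" and H: "H \<in> self_dual_bivectors s g"
  defines "N \<equiv> inverse_metric g"
  shows "F ** N ** (H ** N) + H ** N ** (F ** N) = tscale (- bivector_metric g F H) (mat 1)"
proof -
  obtain P D s' where P: "complexify P ** D = mat 1" "s' = 1 \<or> s' = (- 1 :: real)"
    "inverse_metric g = complexify P ** complexify minkowski ** transpose (complexify P)"
    "pull_back P (complexify g) = complexify minkowski"
    "\<And>F. pull_back P (star2 s g F) = star2 s' minkowski (pull_back P F)"
    using complex_tetrad[OF assms(1,2)] by metis
  note sd = pull_back_self_dual[OF P(5)]
  obtain c where "pull_back P F ** complexify minkowski ** pull_back P H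
      + pull_back P H ** complexify minkowski ** pull_back P F = tscale c (complexify minkowski)"
    using self_dual_anticommute_minkowski[OF P(2) sd[OF F] sd[OF H]] by blast
  then have "pull_back P (F ** N ** H + H ** N ** F) = pull_back P (tscale c (complexify g))"
    unfolding N_def pull_back_linear pull_back_mult[OF P(3)] P(4) .
  then have "F ** N ** H + H ** N ** F = tscale c (complexify g)"
    by (rule pull_back_inj[OF P(1)])
  then have "(F ** N ** H + H ** N ** F) ** N = tscale c (mat 1)"
    by (simp add: N_def inverse_metric_left_inverse[OF assms(1)])
  then have *: "F ** N ** (H ** N) + H ** N ** (F ** N) = tscale c (mat 1)"
    by (simp add: matrix_add_rdistrib matrix_mul_assoc)
  \<comment> \<open>The contraction becomes a trace of the transpose of \<open>H\<close>;
    antisymmetry of \<open>H\<close> supplies the sign.\<close>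
  have "bivector_metric g F H = - 1/2 * trace (F ** N ** (H ** N))"
    using H by (simp add: bivector_metric_eq raise2_eq transpose_inverse_metric[OF assms(1)] matrix_transpose_mul
        self_dual_bivectors_def N_def matrix_mul_assoc trace_def sum_negf)
  moreover have "trace (F ** N ** (H ** N)) + trace (H ** N ** (F ** N)) = 4 * c"
    using arg_cong[OF *, of trace] by (simp add: trace_add trace_tscale trace_I)
  moreover have "trace (H ** N ** (F ** N)) = trace (F ** N ** (H ** N))"
    by (rule trace_mul_sym)
  ultimately have "c = - bivector_metric g F H" by simp
  with * show ?thesis by simp
qed

lemma tscale_simps [simp]: "tscale 0 A = 0" "tscale c 0 = 0" "tscale 1 A = A" "tscale a (tscale b A) = tscale (a * b) A"
  by (simp_all add: vec_eq_iff)

section \<open>Orthonormal frames of self-dual bivectors\<close>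

lemma tconj_uminus: "tconj (- A) = - tconj A"
  by (simp add: vec_eq_iff)

lemma trace_uminus: "trace (- A :: complex^4^4) = - trace A"
  by (simp add: trace_def sum_negf)

lemma tconj_mat1 [simp]: "tconj (mat 1) = mat 1"
  by (simp add: vec_eq_iff mat_def)

lemma tconj_0 [simp]: "tconj 0 = 0"
  by (simp add: vec_eq_iff)

lemma double_eq_mat1D:
  assumes "A + A = (mat 1 :: tensor2)"
  shows "A = tscale (1/2) (mat 1)"
  using assms unfolding vec_eq_iff by (auto simp: field_simps)

text \<open>Conjugation by \<open>K\<close> fixes the trace of \<open>A ** B\<close> but reverses its sign.\<close>

lemma anticommuting_trace_zero:
  fixes A B K :: tensor2
  assumes "K ** K = tscale (1/2) (mat 1)" "K ** A = - (A ** K)" "K ** B = B ** K"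
  shows "trace (A ** B) = 0"
proof -
  have "trace (K ** (A ** B ** K)) = trace (A ** B ** K ** K)"
    by (rule trace_mul_sym)
  also have "\<dots> = 1/2 * trace (A ** B)"
    by (simp add: assms(1) trace_tscale flip: matrix_mul_assoc)
  finally have "trace (K ** (A ** B ** K)) = 1/2 * trace (A ** B)" .
  moreover have "K ** (A ** B ** K) = - (A ** (B ** (K ** K)))"
  proof -
    have "K ** (A ** B ** K) = K ** A ** (B ** K)" by (simp add: matrix_mul_assoc)
    also have "\<dots> = - (A ** (K ** B) ** K)" by (simp add: assms(2) matrix_mul_assoc)
    also have "\<dots> = - (A ** (B ** (K ** K)))" unfolding assms(3) by (simp add: matrix_mul_assoc)
    finally show ?thesis .
  qed
  then have "trace (K ** (A ** B ** K)) = - (1/2 * trace (A ** B))"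
    by (simp add: assms(1) trace_tscale trace_uminus)
  ultimately show ?thesis by simp
qed

text \<open>The complex bilinear form induced by the metric on all 2-tensors, without conjugation
  and without the factor 1/2 of \<open>bivector_metric\<close>.\<close>

definition pairing :: "real^4^4 \<Rightarrow> tensor2 \<Rightarrow> tensor2 \<Rightarrow> complex" where
  "pairing g A B = (\<Sum>a\<in>UNIV. \<Sum>b\<in>UNIV. raise2 g A $ a $ b * B $ a $ b)"

section \<open>The Clifford algebra of an orthonormal frame and the tensors
  \<open>Pi\<close>\<close>

locale sd_frame =
  fixes g :: "real^4^4" and s :: real and U :: "3 \<Rightarrow> tensor2"
  assumes lor: "lorentzian g" and s: "s = 1 \<or> s = - 1" and frame: "orthonormal_sd_frame s g U"
begin

abbreviation N :: tensor2 where "N \<equiv> inverse_metric g"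

text \<open>Raising the second index turns contractions of bivectors into matrix products and the
  frame into Clifford generators.\<close>

definition M :: "3 \<Rightarrow> tensor2" where "M i = U i ** N"
definition Mb :: "3 \<Rightarrow> tensor2" where "Mb i = tconj (U i) ** N"
definition Pi :: "3 \<Rightarrow> 3 \<Rightarrow> tensor2" where "Pi i j = U i ** N ** tconj (U j)"

lemma transpose_N: "transpose N = N"
  by (rule transpose_inverse_metric[OF lor])

lemma tconj_N: "tconj N = N"
  by (simp add: inverse_metric_def)

lemma pairing_eq: "pairing g A B = trace (N ** A ** N ** transpose B)"
proof -
  have "pairing g A B = trace (raise2 g A ** transpose B)"
    by (simp add: pairing_def trace_def matrix_matrix_mult_def transpose_def)
  then show ?thesis by (simp add: raise2_eq transpose_N)
qed

lemma bivector_metric_pairing: "bivector_metric g F H = 1/2 * pairing g H F"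
  by (simp add: bivector_metric_def pairing_def mult.commute)

lemma U_self_dual: "U i \<in> self_dual_bivectors s g"
  using frame tensor2.span_superset[of "range U"] unfolding orthonormal_sd_frame_def by auto

lemma transpose_U: "transpose (U i) = - U i"
  using U_self_dual by (simp add: self_dual_bivectors_def)

lemma metric_U: "bivector_metric g (U i) (U j) = (if i = j then - 1 else 0)"
  using frame unfolding orthonormal_sd_frame_def by blast

lemma M_anticommute: "M i ** M j + M j ** M i = (if i = j then mat 1 else 0)"
  unfolding M_def self_dual_anticommute[OF lor s U_self_dual U_self_dual] metric_U by simp

lemma Mb_eq: "Mb i = tconj (M i)"
  by (simp add: Mb_def M_def tconj_mult tconj_N)

lemma Mb_anticommute: "Mb i ** Mb j + Mb j ** Mb i = (if i = j then mat 1 else 0)"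
  using arg_cong[OF M_anticommute[of i j], of tconj] by (auto simp: tconj_add tconj_mult Mb_eq)

lemma M_square: "M i ** M i = tscale (1/2) (mat 1)"
  using M_anticommute[of i i] by (intro double_eq_mat1D) simp

lemma M_swap: "i \<noteq> j \<Longrightarrow> M i ** M j = - (M j ** M i)"
  using M_anticommute[of i j] by (simp add: eq_neg_iff_add_eq_0)

lemma M_Mb_commute: "M i ** Mb j = Mb j ** M i"
  using self_dual_conj_commute[OF lor s U_self_dual[of i] U_self_dual[of j]]
  unfolding M_def Mb_def by (simp add: matrix_mul_assoc)

lemma trace_M_Mb: "trace (M i ** Mb j) = 0"
proof -
  \<comment> \<open>Any other generator works: \<open>M k\<close> anticommutes with
    \<open>M i\<close> and commutes with \<open>Mb j\<close>.\<close>
  obtain k where "k \<noteq> i" by (metis one_neq_zero)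
  show ?thesis
    by (rule anticommuting_trace_zero[OF M_square[of k] M_swap[OF \<open>k \<noteq> i\<close>] M_Mb_commute])
qed

lemma trace_Mb_Mb: "trace (Mb i ** Mb j) = (if i = j then 2 else 0)"
proof -
  have "trace (Mb i ** Mb j) + trace (Mb j ** Mb i) = (if i = j then 4 else 0)"
    using arg_cong[OF Mb_anticommute[of i j], of trace] by (auto simp: trace_add trace_I trace_0 trace_def[of 0])
  then show ?thesis
    unfolding trace_mul_sym[of "Mb j"] by (auto split: if_splits)
qed

text \<open>For \<open>i = k\<close> the square is half the identity and the trace of two conjugate
  generators remains. Otherwise \<open>M i\<close> anticommutes with \<open>M i ** M k\<close> and
  commutes with the conjugate factors.\<close>

lemma trace_M_M_Mb_Mb: "trace ((M i ** M k) ** (Mb j ** Mb l)) = (if i = k \<and> j = l then 1 else 0)"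
proof (cases "i = k")
  case True
  then show ?thesis by (simp add: M_square trace_tscale trace_Mb_Mb)
next
  case False
  have "M i ** (M i ** M k) = - (M i ** M k ** M i)"
    unfolding matrix_mul_assoc[symmetric, of _ _ "M i"] M_swap[OF False[symmetric]] by simp
  moreover have "M i ** (Mb j ** Mb l) = Mb j ** Mb l ** M i"
    unfolding matrix_mul_assoc[of "M i"] M_Mb_commute[of i j] matrix_mul_assoc[symmetric] M_Mb_commute[of i l] ..
  ultimately show ?thesis
    using anticommuting_trace_zero[OF M_square[of i]] False by simp
qed

lemma Pi_N: "Pi i j ** N = M i ** Mb j"
  by (simp add: Pi_def M_def Mb_def matrix_mul_assoc)

lemma transpose_tconj_U: "transpose (tconj (U i)) = - tconj (U i)"
  by (simp add: transpose_U tconj_uminus flip: tconj_transpose)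

text \<open>Transposition reverses the product and yields two cancelling signs, so symmetry is the
  commutation of the frame with its conjugate.\<close>

lemma transpose_Pi: "transpose (Pi i j) = Pi i j"
  using self_dual_conj_commute[OF lor s U_self_dual[of i] U_self_dual[of j]]
  by (simp add: Pi_def matrix_transpose_mul transpose_N transpose_U transpose_tconj_U matrix_mul_assoc)

text \<open>Commuting \<open>Mb j\<close> past \<open>M k\<close> separates the generators from
  their conjugates and leaves the trace already computed.\<close>

lemma pairing_Pi: "pairing g (Pi i j) (Pi k l) = (if i = k \<and> j = l then 1 else 0)"
proof -
  have "pairing g (Pi i j) (Pi k l) = trace (Pi i j ** N ** (Pi k l ** N))"
    unfolding pairing_eq transpose_Pi
    using trace_mul_sym[of N "Pi i j ** N ** Pi k l"] by (simp add: matrix_mul_assoc)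
  also have "Pi i j ** N ** (Pi k l ** N) = M i ** (Mb j ** M k) ** Mb l"
    unfolding Pi_N by (simp add: matrix_mul_assoc)
  also have "\<dots> = M i ** M k ** (Mb j ** Mb l)"
    unfolding M_Mb_commute[symmetric] by (simp add: matrix_mul_assoc)
  finally show ?thesis by (simp only: trace_M_M_Mb_Mb)
qed

lemma Pi_traceless_symmetric: "Pi i j \<in> traceless_symmetric g"
proof -
  have "(\<Sum>a\<in>UNIV. \<Sum>b\<in>UNIV. ginv g a b * Pi i j $ a $ b) = trace (transpose N ** Pi i j)"
    by (subst sum.swap) (simp add: trace_def matrix_matrix_mult_def transpose_def)
  also have "\<dots> = 0"
    unfolding transpose_N by (subst trace_mul_sym) (simp add: Pi_N trace_M_Mb)
  finally show ?thesis
    by (simp add: traceless_symmetric_def transpose_Pi)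
qed

end

section \<open>The self-dual Weyl tensor\<close>

text \<open>Renaming the summation indices cyclically writes the same sum in three ways; their total
  contains the vanishing cyclic sum of \<open>z\<close>.\<close>

lemma cyclic_sum_zero:
  fixes e z :: "'a::finite \<Rightarrow> 'a \<Rightarrow> 'a \<Rightarrow> complex"
  assumes e: "\<And>a k l. e k l a = e a k l" and z: "\<And>a k l. z a k l + z k l a + z l a k = 0"
  shows "(\<Sum>a\<in>UNIV. \<Sum>k\<in>UNIV. \<Sum>l\<in>UNIV. e a k l * z a k l) = 0" (is "?S = 0")
proof -
  have 1: "?S = (\<Sum>a\<in>UNIV. \<Sum>k\<in>UNIV. \<Sum>l\<in>UNIV. e a k l * z k l a)"
  proof -
    have "?S = (\<Sum>a\<in>UNIV. \<Sum>k\<in>UNIV. \<Sum>l\<in>UNIV. e k l a * z k l a)"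
      by (rule trans[OF sum_rotate]) (rule trans[OF sum_rotate], rule refl)
    moreover have "e k l a * z k l a = e a k l * z k l a" for a k l
      by (rule arg_cong2[OF e refl])
    ultimately show ?thesis by simp
  qed
  have 2: "?S = (\<Sum>a\<in>UNIV. \<Sum>k\<in>UNIV. \<Sum>l\<in>UNIV. e a k l * z l a k)"
  proof -
    have "?S = (\<Sum>a\<in>UNIV. \<Sum>k\<in>UNIV. \<Sum>l\<in>UNIV. e l a k * z l a k)"
      by (rule sum_rotate)
    moreover have "e l a k * z l a k = e a k l * z l a k" for a k l
      by (rule arg_cong2[OF e[symmetric] refl])
    ultimately show ?thesis by simp
  qed
  have "?S + ?S + ?S = (\<Sum>a\<in>UNIV. \<Sum>k\<in>UNIV. \<Sum>l\<in>UNIV. e a k l * (z a k l + z k l a + z l a k))"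
    unfolding arg_cong2[where f="(+)", OF arg_cong2[where f="(+)", OF refl[of ?S] 1] 2]
    by (simp add: distrib_left sum.distrib)
  also have "\<dots> = 0" by (simp add: z)
  finally have "3 * ?S = 0" by (simp add: algebra_simps)
  then show ?thesis by simp
qed

text \<open>Fixes the last index pair, so that a 4-tensor becomes a family of bivectors to which
  \<open>star2\<close> applies.\<close>

definition col34 :: "tensor4 \<Rightarrow> 4 \<Rightarrow> 4 \<Rightarrow> tensor2" where
  "col34 X m n = (\<chi> a b. X a b m n)"

lemma ginv_commute:
  assumes "lorentzian g"
  shows "ginv g a b = ginv g b a"
  using arg_cong[OF transpose_inverse_metric[OF assms], of "\<lambda>A. A $ a $ b"] by (simp add: transpose_def)

text \<open>Symmetry of \<open>ginv\<close> allows the raised indices to sit on the volume element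
  or on the tensor alike.\<close>

lemma star4_eq_star2:
  assumes "lorentzian g"
  shows "star4 s g W a b m n = star2 s g (col34 (\<lambda>a b c d. complex_of_real (W a b c d)) m n) $ a $ b"
proof -
  let ?v = "\<lambda>k l. complex_of_real (volume_element s g a b k l)"
  have "star4 s g W a b m n = 1/2 * (\<Sum>p\<in>UNIV. \<Sum>q\<in>UNIV. \<Sum>k\<in>UNIV. \<Sum>l\<in>UNIV.
      ginv g k p * ginv g l q * ?v k l * complex_of_real (W p q m n))"
    by (simp add: star4_def raise34_def sum_distrib_right ginv_commute[OF assms, of _ "_::4"])
  also have "\<dots> = 1/2 * (\<Sum>k\<in>UNIV. \<Sum>l\<in>UNIV. \<Sum>p\<in>UNIV. \<Sum>q\<in>UNIV.
      ginv g k p * ginv g l q * ?v k l * complex_of_real (W p q m n))"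
    by (subst sum_swap_pairs) (rule refl)
  also have "\<dots> = star2 s g (col34 (\<lambda>a b c d. complex_of_real (W a b c d)) m n) $ a $ b"
    by (simp add: star2_def raise2_def col34_def sum_distrib_left mult_ac)
  finally show ?thesis .
qed

lemma star2_linear:
  "star2 s g (A + B) = star2 s g A + star2 s g B" "star2 s g (tscale c A) = tscale c (star2 s g A)"
  "star2 s g (- A) = - star2 s g A" "star2 s g (tconj A) = tconj (star2 s g A)"
  by (simp_all add: star2_def raise2_def vec_eq_iff sum_distrib_left sum.distrib distrib_left sum_negf
      ginv_def mult_ac)

text \<open>The projection of bivectors onto the eigenspace of the dual for \<open>\<i>\<close>; it
  uses that the dual squares to minus the identity.\<close>

definition sd_part :: "real \<Rightarrow> real^4^4 \<Rightarrow> tensor2 \<Rightarrow> tensor2" where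
  "sd_part s g F = tscale (1/2) (F + tscale (- \<i>) (star2 s g F))"

lemma sd_part_self_dual:
  assumes "lorentzian g" "s = 1 \<or> s = - 1" "transpose F = - F"
  shows "sd_part s g F \<in> self_dual_bivectors s g"
proof -
  have "star2 s g (sd_part s g F) = tscale \<i> (sd_part s g F)"
    unfolding sd_part_def star2_linear star2_star2[OF assms]
    by (simp add: vec_eq_iff algebra_simps)
  moreover have "transpose (sd_part s g F) = - sd_part s g F"
    unfolding sd_part_def transpose_tscale transpose_add assms(3) transpose_star2
    by (simp add: vec_eq_iff algebra_simps)
  ultimately show ?thesis by (simp add: self_dual_bivectors_def)
qed

text \<open>The second summand is the anti-self-dual part: conjugation exchanges the two eigenspaces of the dual.\<close>

lemma sd_part_decomposition: "F = sd_part s g F + tconj (sd_part s g (tconj F))"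
  by (simp add: sd_part_def star2_linear tconj_add tconj_tscale vec_eq_iff algebra_simps)

lemma col34_sd_weyl:
  assumes "lorentzian g"
  shows "col34 (sd_weyl s g W) m n = sd_part s g (col34 (\<lambda>a b c d. complex_of_real (W a b c d)) m n)"
  by (simp add: vec_eq_iff sd_part_def sd_weyl_def col34_def star4_eq_star2[OF assms])

text \<open>This trace contracts the volume element with three indices of \<open>W\<close>, so it
  vanishes by the cyclic identity.\<close>

lemma star4_traceless:
  assumes "lorentzian g" and W: "weyl_tensor g W"
  shows "(\<Sum>a\<in>UNIV. \<Sum>m\<in>UNIV. ginv g a m * star4 s g W a b m n) = 0"
proof -
  \<comment> \<open>The Weyl tensor with its first three indices raised; \<open>n\<close> stays
    fixed here and \<open>b\<close> in \<open>e\<close>.\<close>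
  define z where "z a k l = (\<Sum>m\<in>UNIV. \<Sum>p\<in>UNIV. \<Sum>q\<in>UNIV.
    ginv g a m * ginv g k p * ginv g l q * complex_of_real (W p q m n))" for a k l
  define e where "e a k l = complex_of_real (volume_element s g a b k l)" for a k l
  have e: "e k l a = e a k l" for a k l
  proof -
    have "levi_civita k b l a = levi_civita a b k l"
      by (metis levi_civita_swap minus_minus)
    then show ?thesis by (simp add: e_def volume_element_def)
  qed
  have sym: "W a b c d = - W b a c d" "W a b c d = - W a b d c" "W a b c d = W c d a b" for a b c d
    using W unfolding weyl_tensor_def by blast+
  have bianchi: "W a b c d + W a c d b + W a d b c = 0" for a b c d
    using W unfolding weyl_tensor_def by blast
  \<comment> \<open>The cyclic identity is given for the last three indices; the pair symmetries
    carry it to the first three.\<close>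
  have cyc: "W p q m n + W q m p n + W m p q n = 0" for p q m
  proof -
    have "W p q m n = W n m q p" "W q m p n = W n p m q" "W m p q n = W n q p m"
      by (metis sym minus_minus)+
    then show ?thesis using bianchi[of n m q p] by simp
  qed
  have z: "z a k l + z k l a + z l a k = 0" for a k l
  proof -
    have 1: "z k l a = (\<Sum>m\<in>UNIV. \<Sum>p\<in>UNIV. \<Sum>q\<in>UNIV. ginv g a m * ginv g k p * ginv g l q * complex_of_real (W q m p n))"
      unfolding z_def by (rule trans[OF sum_rotate[symmetric]]) (simp add: mult_ac)
    have 2: "z l a k = (\<Sum>m\<in>UNIV. \<Sum>p\<in>UNIV. \<Sum>q\<in>UNIV. ginv g a m * ginv g k p * ginv g l q * complex_of_real (W m p q n))"
      unfolding z_def by (rule trans[OF sum_rotate]) (simp add: mult_ac)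
    have "z a k l + z k l a + z l a k = (\<Sum>m\<in>UNIV. \<Sum>p\<in>UNIV. \<Sum>q\<in>UNIV. ginv g a m * ginv g k p * ginv g l q *
        complex_of_real (W p q m n + W q m p n + W m p q n))"
      unfolding 1 2 unfolding z_def by (simp add: distrib_left sum.distrib)
    then show ?thesis by (simp only: cyc) simp
  qed
  have "ginv g a m * star4 s g W a b m n = 1/2 * (\<Sum>k\<in>UNIV. \<Sum>l\<in>UNIV. e a k l * (\<Sum>p\<in>UNIV. \<Sum>q\<in>UNIV.
      ginv g a m * ginv g k p * ginv g l q * complex_of_real (W p q m n)))" for a m
    unfolding star4_eq_star2[OF assms(1)]
    by (simp add: star2_def raise2_def col34_def e_def sum_distrib_left mult_ac)
  then have "(\<Sum>a\<in>UNIV. \<Sum>m\<in>UNIV. ginv g a m * star4 s g W a b m n) =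
     (\<Sum>a\<in>UNIV. 1/2 * (\<Sum>m\<in>UNIV. \<Sum>k\<in>UNIV. \<Sum>l\<in>UNIV. e a k l * (\<Sum>p\<in>UNIV. \<Sum>q\<in>UNIV.
      ginv g a m * ginv g k p * ginv g l q * complex_of_real (W p q m n))))"
    by (simp add: sum_distrib_left)
  also have "\<dots> = (\<Sum>a\<in>UNIV. 1/2 * (\<Sum>k\<in>UNIV. \<Sum>l\<in>UNIV. e a k l * z a k l))"
    by (subst sum_rotate) (simp add: z_def sum_distrib_left)
  also have "\<dots> = 1/2 * (\<Sum>a\<in>UNIV. \<Sum>k\<in>UNIV. \<Sum>l\<in>UNIV. e a k l * z a k l)"
    by (simp add: sum_distrib_left)
  also have "\<dots> = 0"
    by (subst cyclic_sum_zero[of e z, OF e z]) simp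
  finally show ?thesis .
qed

lemma sd_weyl_traceless:
  assumes "lorentzian g" and W: "weyl_tensor g W"
  shows "(\<Sum>a\<in>UNIV. \<Sum>m\<in>UNIV. ginv g a m * sd_weyl s g W a b m n) = 0"
proof -
  have "(\<Sum>a\<in>UNIV. \<Sum>m\<in>UNIV. matrix_inv g $ a $ m * W a b m n) = 0"
    using W unfolding weyl_tensor_def by blast
  then have "complex_of_real (\<Sum>a\<in>UNIV. \<Sum>m\<in>UNIV. matrix_inv g $ a $ m * W a b m n) = 0"
    by simp
  then have 1: "(\<Sum>a\<in>UNIV. \<Sum>m\<in>UNIV. ginv g a m * complex_of_real (W a b m n)) = 0"
    by (simp add: ginv_def)
  have "(\<Sum>a\<in>UNIV. \<Sum>m\<in>UNIV. ginv g a m * sd_weyl s g W a b m n) =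
    1/2 * ((\<Sum>a\<in>UNIV. \<Sum>m\<in>UNIV. ginv g a m * complex_of_real (W a b m n))
      - \<i> * (\<Sum>a\<in>UNIV. \<Sum>m\<in>UNIV. ginv g a m * star4 s g W a b m n))"
    by (simp add: sd_weyl_def sum_distrib_left sum_subtractf algebra_simps)
  then show ?thesis
    unfolding 1 star4_traceless[OF assms] by simp
qed

section \<open>Sums of outer products acting on 2-tensors\<close>

lemma raise34_sum_outer:
  assumes "\<And>a b c d. X a b c d = (\<Sum>i\<in>I. outer (A i) (B i) a b c d)"
  shows "raise34 g X a b m n = (\<Sum>i\<in>I. A i $ a $ b * raise2 g (B i) $ m $ n)"
  unfolding raise34_def raise2_def assms outer_def
  by (simp add: sum_distrib_left sum_rotate[where B=I, symmetric] mult_ac)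

lemma contract_sum_outer:
  assumes "\<And>a b c d. X a b c d = (\<Sum>i\<in>I. outer (A i) (B i) a b c d)"
  shows "(\<Sum>m\<in>UNIV. \<Sum>n\<in>UNIV. raise34 g X a b m n * F $ m $ n) = (\<Sum>i\<in>I. A i $ a $ b * pairing g (B i) F)"
  unfolding raise34_sum_outer[OF assms] pairing_def
  by (simp add: sum_distrib_left sum_distrib_right sum_rotate[where B=I] mult_ac)

lemma sd_part_uminus: "sd_part s g (- F) = - sd_part s g F"
  by (simp add: sd_part_def star2_linear vec_eq_iff algebra_simps)

lemma trace_transpose: "trace (transpose A) = trace (A :: complex^4^4)"
  by (simp add: trace_def transpose_def)

lemma trace_sum: "trace (\<Sum>i\<in>I. f i :: complex^4^4) = (\<Sum>i\<in>I. trace (f i))"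
  by (induction I rule: infinite_finite_induct) (simp_all add: trace_add, simp_all add: trace_def)

lemma matrix_mult_sum:
  "(\<Sum>i\<in>I. f i) ** B = (\<Sum>i\<in>I. f i ** (B :: complex^4^4))"
  "B ** (\<Sum>i\<in>I. f i) = (\<Sum>i\<in>I. B ** (f i :: complex^4^4))"
  by (induction I rule: infinite_finite_induct) (simp_all add: matrix_add_rdistrib matrix_add_ldistrib)

lemma bivector_metric_sum:
  "bivector_metric g (\<Sum>i\<in>I. tscale (c i) (F i)) H = (\<Sum>i\<in>I. c i * bivector_metric g (F i) H)"
  by (simp add: bivector_metric_def sum_distrib_left sum_distrib_right sum_rotate[where B=I] mult_ac)

lemma bivector_metric_uminus: "bivector_metric g (- F) H = - bivector_metric g F H"
  by (simp add: bivector_metric_def sum_negf)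

lemma pairing_sum: "pairing g A (\<Sum>i\<in>I. tscale (c i) (B i)) = (\<Sum>i\<in>I. c i * pairing g A (B i))"
  by (simp add: pairing_def sum_distrib_left sum_rotate[where B=I] mult_ac)

lemma pairing_add: "pairing g A (B + C) = pairing g A B + pairing g A C"
  by (simp add: pairing_def distrib_left sum.distrib)

lemma pairing_tscale: "pairing g A (tscale c B) = c * pairing g A B"
  by (simp add: pairing_def sum_distrib_left mult_ac)

context sd_frame
begin

lemma pairing_commute: "pairing g A B = pairing g B A"
proof -
  have "pairing g A B = trace (transpose (N ** A ** N ** transpose B))"
    by (simp only: trace_transpose pairing_eq)
  also have "transpose (N ** A ** N ** transpose B) = (B ** N ** transpose A) ** N"
    by (simp add: matrix_transpose_mul transpose_N matrix_mul_assoc)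
  also have "trace \<dots> = pairing g B A"
    unfolding pairing_eq by (subst trace_mul_sym) (simp add: matrix_mul_assoc)
  finally show ?thesis .
qed

text \<open>Orthonormality identifies the coefficients of the frame expansion; the minus sign
  reflects that the frame elements have square -1.\<close>

lemma self_dual_expand:
  assumes "F \<in> self_dual_bivectors s g"
  shows "F = (\<Sum>i\<in>UNIV. tscale (- bivector_metric g F (U i)) (U i))"
proof -
  have inj: "inj U" and span: "F \<in> tensor2.span (range U)"
    using frame assms by (auto simp: orthonormal_sd_frame_def)
  then obtain c where "F = (\<Sum>v\<in>range U. tscale (c v) v)"
    by (auto simp: tensor2.span_finite)
  then have F: "F = (\<Sum>i\<in>UNIV. tscale (c (U i)) (U i))"
    by (simp add: sum.reindex[OF inj])
  have "bivector_metric g F (U k) = - c (U k)" for k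
    by (subst F) (simp add: bivector_metric_sum metric_U if_distrib cong: if_cong)
  then show ?thesis using F by simp
qed

text \<open>Self-duality is immediate only in the first index pair. In the second pair it is
  extracted from the vanishing trace, which also yields the vanishing sum of the
  eigenvalues.\<close>

lemma sd_weyl_decomposition:
  assumes W: "weyl_tensor g W" and eig: "\<And>i. sd_weyl_map s g W (U i) = tscale (\<rho> i) (U i)"
  shows "sd_weyl s g W p q m n = - (\<Sum>i\<in>UNIV. \<rho> i * outer (U i) (U i) p q m n)"
    and "(\<Sum>i\<in>UNIV. \<rho> i) = 0"
proof -
  define X where "X = sd_weyl s g W"
  define Wc where "Wc = col34 (\<lambda>a b c d. complex_of_real (W a b c d))"
  \<comment> \<open>The frame coefficients of the columns of \<open>X\<close>, regarded as tensors
    in the two remaining indices.\<close>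
  define V where "V i = (\<chi> m n. - bivector_metric g (col34 X m n) (U i))" for i
  have sym: "W a b c d = - W b a c d" "W a b c d = - W a b d c" for a b c d
    using W unfolding weyl_tensor_def by blast+
  have X_col: "col34 X m n = sd_part s g (Wc m n)" for m n
    by (simp add: X_def Wc_def col34_sd_weyl[OF lor])
  have "transpose (Wc m n) = - Wc m n" for m n
  proof (rule antisymmetricI)
    fix a b
    have "W b a m n = - W a b m n" by (rule sym)
    then show "Wc m n $ b $ a = - Wc m n $ a $ b" by (simp add: Wc_def col34_def)
  qed
  then have X_sd: "col34 X m n \<in> self_dual_bivectors s g" for m n
    unfolding X_col by (intro sd_part_self_dual lor s)
  have X: "X a b m n = (\<Sum>i\<in>UNIV. outer (U i) (V i) a b m n)" for a b m n
  proof -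
    have "col34 X m n $ a $ b = (\<Sum>i\<in>UNIV. U i $ a $ b * V i $ m $ n)"
      by (subst self_dual_expand[OF X_sd]) (simp add: V_def mult.commute)
    then show ?thesis by (simp add: col34_def outer_def)
  qed
  have V_anti: "transpose (V i) = - V i" for i
  proof (rule antisymmetricI)
    fix m n
    have "W a b n m = - W a b m n" for a b by (rule sym)
    then have "Wc n m = - Wc m n" by (simp add: Wc_def col34_def vec_eq_iff)
    then have "col34 X n m = - col34 X m n"
      by (simp add: X_col sd_part_uminus)
    then show "V i $ n $ m = - V i $ m $ n"
      by (simp add: V_def bivector_metric_uminus)
  qed
  \<comment> \<open>\<open>V i\<close> has a self-dual part, fixed by the eigenvalue equations, and an anti-self-dual part \<open>d\<close>,
    which tracelessness of the Weyl tensor excludes.\<close>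
  define c where "c i j = - bivector_metric g (sd_part s g (V i)) (U j)" for i j
  \<comment> \<open>The conjugate of the anti-self-dual part is self-dual; its frame coefficients
    are conjugated back.\<close>
  define d where "d i j = cnj (- bivector_metric g (sd_part s g (tconj (V i))) (U j))" for i j
  have V_expand: "V i = (\<Sum>j\<in>UNIV. tscale (c i j) (U j)) + (\<Sum>j\<in>UNIV. tscale (d i j) (tconj (U j)))" for i
  proof -
    have "transpose (tconj (V i)) = - tconj (V i)"
      by (simp add: V_anti tconj_uminus flip: tconj_transpose)
    then have "sd_part s g (tconj (V i)) = (\<Sum>j\<in>UNIV. tscale (cnj (d i j)) (U j))"
      using self_dual_expand[OF sd_part_self_dual[OF lor s]] by (simp add: d_def)
    then have "tconj (sd_part s g (tconj (V i))) = (\<Sum>j\<in>UNIV. tscale (d i j) (tconj (U j)))"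
      by (simp add: vec_eq_iff)
    moreover have "sd_part s g (V i) = (\<Sum>j\<in>UNIV. tscale (c i j) (U j))"
      using self_dual_expand[OF sd_part_self_dual[OF lor s V_anti]] by (simp add: c_def)
    ultimately show ?thesis
      using sd_part_decomposition[of "V i" s g] by metis
  qed
  have map: "sd_weyl_map s g W F = (\<Sum>i\<in>UNIV. tscale (1/2 * pairing g (V i) F) (U i))" for F
    unfolding sd_weyl_map_def X_def[symmetric]
    by (subst contract_sum_outer[OF X]) (simp add: vec_eq_iff sum_distrib_left mult_ac)
  have VU: "1/2 * pairing g (V j) (U k) = (if j = k then \<rho> k else 0)" for j k
  proof -
    have "(\<Sum>i\<in>UNIV. tscale (1/2 * pairing g (V i) (U k)) (U i)) = (\<Sum>i\<in>UNIV. tscale (if i = k then \<rho> k else 0) (U i))"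
      using eig[of k] unfolding map by (simp add: if_distribR if_distrib[of "\<lambda>c. tscale c _"] cong: if_cong)
    then have "bivector_metric g (\<Sum>i\<in>UNIV. tscale (1/2 * pairing g (V i) (U k)) (U i)) (U j)
      = bivector_metric g (\<Sum>i\<in>UNIV. tscale (if i = k then \<rho> k else 0) (U i)) (U j)" by (rule arg_cong)
    then show ?thesis
      unfolding bivector_metric_sum metric_U by (simp add: if_distrib[of "(*) _"] cong: if_cong split: if_splits)
  qed
  \<comment> \<open>Orthogonality of the two dualities makes \<open>d\<close> drop out when
    \<open>V j\<close> is paired with \<open>U k\<close>.\<close>
  have "pairing g (U k) (tconj (U j)) = 0" for j k
  proof -
    have "pairing g (U k) (tconj (U j)) = - trace (N ** (U k ** N ** tconj (U j)))"
      by (simp add: pairing_eq transpose_tconj_U trace_uminus matrix_mul_assoc)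
    also have "\<dots> = 0"
      by (subst trace_mul_sym) (simp flip: Pi_def add: Pi_N trace_M_Mb)
    finally show ?thesis .
  qed
  then have cV: "1/2 * pairing g (V j) (U k) = - c j k" for j k
    unfolding pairing_commute[of "V j"] unfolding V_expand pairing_add pairing_sum
    using metric_U[of _ k] by (simp add: sum_distrib_left if_distrib[of "(*) _"] bivector_metric_pairing
        cong: if_cong)
  have c: "c j k = - (if j = k then \<rho> k else 0)" for j k
    using VU[of j k] unfolding cV by (metis minus_minus)
  \<comment> \<open>Up to sign, this matrix is the trace of \<open>X\<close> over its first and
    third indices.\<close>
  have "(\<Sum>i\<in>UNIV. U i ** N ** V i) = 0"
  proof -
    have "(\<Sum>i\<in>UNIV. U i ** N ** V i) $ b $ n = 0" for b n
    proof -
      have "(\<Sum>i\<in>UNIV. U i ** N ** V i) $ b $ n = (\<Sum>i\<in>UNIV. \<Sum>m\<in>UNIV. \<Sum>a\<in>UNIV. U i $ b $ a * ginv g a m * V i $ m $ n)"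
        by (simp add: matrix_matrix_mult_def sum_distrib_right)
      also have "\<dots> = (\<Sum>a\<in>UNIV. \<Sum>m\<in>UNIV. \<Sum>i\<in>UNIV. U i $ b $ a * ginv g a m * V i $ m $ n)"
        by (subst sum_rotate) (rule sum.swap)
      also have "\<dots> = - (\<Sum>a\<in>UNIV. \<Sum>m\<in>UNIV. ginv g a m * X a b m n)"
        by (simp add: X outer_def sum_distrib_left antisymmetric_nth[OF transpose_U, of _ b] mult_ac flip: sum_negf)
      finally show ?thesis
        using sd_weyl_traceless[OF lor W] by (simp add: X_def)
    qed
    then show ?thesis by (simp add: vec_eq_iff)
  qed
  then have "(\<Sum>i\<in>UNIV. U i ** N ** V i) ** N = 0" by simp
  then have *: "(\<Sum>i\<in>UNIV. M i ** (V i ** N)) = 0"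
    by (simp add: matrix_mult_sum M_def matrix_mul_assoc)
  have VN: "V i ** N = tscale (- \<rho> i) (M i) + (\<Sum>j\<in>UNIV. tscale (d i j) (Mb j))" for i
  proof -
    have cU: "(\<Sum>j\<in>UNIV. tscale (c i j) (U j)) = tscale (- \<rho> i) (U i)"
      by (simp add: c if_distrib[of "\<lambda>c. tscale c _"] if_distrib[of uminus] cong: if_cong)
    show ?thesis
      by (subst V_expand) (simp only: cU matrix_add_rdistrib matrix_mult_sum tscale_mult M_def Mb_def)
  qed
  have E: "tscale (- 1/2 * (\<Sum>i\<in>UNIV. \<rho> i)) (mat 1) + (\<Sum>i\<in>UNIV. \<Sum>j\<in>UNIV. tscale (d i j) (M i ** Mb j)) = 0"
    using * unfolding VN
    by (simp add: matrix_add_ldistrib matrix_mult_sum M_square sum.distrib del: tensor2.scale_minus_left)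
      (simp add: vec_eq_iff sum_distrib_right sum_negf sum_divide_distrib)
  show sum0: "(\<Sum>i\<in>UNIV. \<rho> i) = 0"
    using arg_cong[OF E, of trace] by (simp add: trace_add trace_sub trace_tscale trace_sum trace_M_Mb trace_I trace_def[of 0])
  have d: "d k l = 0" for k l
  proof -
    have "(\<Sum>i\<in>UNIV. \<Sum>j\<in>UNIV. tscale (d i j) (M i ** Mb j)) = 0"
      using E by (simp add: sum0)
    \<comment> \<open>The mixed products are orthonormal for the trace form, so this multiplication
      isolates \<open>d k l\<close>.\<close>
    then have "trace ((\<Sum>i\<in>UNIV. \<Sum>j\<in>UNIV. tscale (d i j) (M i ** Mb j)) ** (M k ** Mb l)) = 0"
      by (simp add: trace_def)
    moreover have "trace (M i ** Mb j ** (M k ** Mb l)) = (if i = k \<and> j = l then 1 else 0)" for i j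
    proof -
      have "M i ** Mb j ** (M k ** Mb l) = M i ** (Mb j ** M k) ** Mb l"
        by (simp add: matrix_mul_assoc)
      also have "\<dots> = M i ** M k ** (Mb j ** Mb l)"
        unfolding M_Mb_commute[symmetric] by (simp add: matrix_mul_assoc)
      finally show ?thesis by (simp only: trace_M_M_Mb_Mb)
    qed
    ultimately have "(\<Sum>i\<in>UNIV. \<Sum>j\<in>UNIV. d i j * (if i = k \<and> j = l then 1 else 0)) = 0"
      by (simp add: matrix_mult_sum trace_sum trace_tscale)
    moreover have "d i j * (if i = k \<and> j = l then 1 else 0) = (if j = l then if i = k then d k l else 0 else 0)" for i j
      by simp
    ultimately show ?thesis by simp
  qed
  have "V i = tscale (- \<rho> i) (U i)" for i
    by (subst V_expand) (simp add: c d if_distrib[of "\<lambda>c. tscale c _"] if_distrib[of uminus] cong: if_cong)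
  then show "sd_weyl s g W p q m n = - (\<Sum>i\<in>UNIV. \<rho> i * outer (U i) (U i) p q m n)"
    using X[of p q m n] by (simp add: X_def outer_def sum_negf mult_ac)
qed

end

section \<open>Eigenvalues and the Bel-Robinson tensor\<close>

text \<open>The dual functionals \<open>\<phi>\<close> make the trace computable in whatever basis \<^const>\<open>trace_on\<close> picks.\<close>

lemma trace_on_diagonal:
  fixes \<phi> :: "'i::finite \<Rightarrow> tensor2 \<Rightarrow> complex" and U :: "'i \<Rightarrow> tensor2"
  assumes ind: "tensor2.independent (range U)" and span: "tensor2.span (range U) = S"
    and f: "\<And>x. x \<in> S \<Longrightarrow> f x = (\<Sum>i\<in>UNIV. tscale (l i * \<phi> i x) (U i))"
    and lin: "\<And>i c (B :: tensor2 set). \<phi> i (\<Sum>v\<in>B. tscale (c v) v) = (\<Sum>v\<in>B. c v * \<phi> i v)"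
    and dual: "\<And>i. \<phi> i (U i) = 1"
  shows "trace_on S f = (\<Sum>i\<in>UNIV. l i)"
proof -
  define B where "B = (SOME B. tensor2.independent B \<and> tensor2.span B = S)"
  have "\<exists>B. tensor2.independent B \<and> tensor2.span B = S" using ind span by blast
  then have "tensor2.independent B \<and> tensor2.span B = S" unfolding B_def by (rule someI_ex)
  then have B: "tensor2.independent B" "tensor2.span B = S" by auto
  have US: "U i \<in> tensor2.span B" for i
    unfolding B(2) span[symmetric] by (rule tensor2.span_base) simp
  have BS: "B \<subseteq> tensor2.span (range U)"
    using tensor2.span_superset[of B] by (simp add: span B(2))
  then have fin: "finite B"
    using tensor2.independent_span_bound[OF _ B(1) BS] by simp
  have "trace_on S f = (\<Sum>v\<in>B. tensor2.representation B (f v) v)"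
    by (simp add: trace_on_def B_def Let_def)
  also have "\<dots> = (\<Sum>v\<in>B. \<Sum>i\<in>UNIV. l i * (tensor2.representation B (U i) v * \<phi> i v))"
  proof (rule sum.cong[OF refl])
    fix v assume "v \<in> B"
    then have "v \<in> S" using BS span by auto
    then show "tensor2.representation B (f v) v = (\<Sum>i\<in>UNIV. l i * (tensor2.representation B (U i) v * \<phi> i v))"
      by (simp add: f tensor2.representation_sum[OF B(1) tensor2.span_scale[OF US]]
          tensor2.representation_scale[OF B(1) US] mult_ac)
  qed
  also have "\<dots> = (\<Sum>i\<in>UNIV. l i * (\<Sum>v\<in>B. tensor2.representation B (U i) v * \<phi> i v))"
    by (subst sum.swap) (simp add: sum_distrib_left)
  \<comment> \<open>The inner sum is \<open>\<phi> i\<close> applied to the expansion of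
    \<open>U i\<close> in \<open>B\<close>, hence 1.\<close>
  also have "\<dots> = (\<Sum>i\<in>UNIV. l i)"
    unfolding lin[symmetric] tensor2.sum_representation_eq[OF B(1) US fin subset_refl] by (simp add: dual)
  finally show ?thesis .
qed

text \<open>The first two power sums vanish, hence so do the first two elementary symmetric
  functions: each \<open>r i\<close> has cube \<open>r 1 * r 2 * r 3\<close>. The third power sum
  excludes zero, and thereby coincidences.\<close>

lemma cube_root_relations:
  fixes r :: "3 \<Rightarrow> complex"
  assumes s1: "r 1 + r 2 + r 3 = 0" and s2: "(r 1)\<^sup>2 + (r 2)\<^sup>2 + (r 3)\<^sup>2 = 0"
    and s3: "(r 1)^3 + (r 2)^3 + (r 3)^3 \<noteq> 0"
  shows "r i \<noteq> 0" and "i \<noteq> j \<Longrightarrow> r i \<noteq> r j" and "cmod (r i) = cmod (r j)"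
    and "r 1 * cnj (r 2) = r 2 * cnj (r 3)" and "r 2 * cnj (r 3) = r 3 * cnj (r 1)"
proof -
  have e: "r 3 = - r 1 - r 2" using s1 by algebra
  have q: "(r 1)\<^sup>2 + r 1 * r 2 + (r 2)\<^sup>2 = 0"
  proof -
    have "2 * ((r 1)\<^sup>2 + r 1 * r 2 + (r 2)\<^sup>2) = 0" using s2 unfolding e by algebra
    then show ?thesis unfolding mult_eq_0_iff by simp
  qed
  have p: "r 1 * r 3 = (r 2)\<^sup>2" "r 1 * r 2 = (r 3)\<^sup>2" "r 2 * r 3 = (r 1)\<^sup>2"
    using q e by algebra+
  have nz: "r 1 \<noteq> 0" "r 2 \<noteq> 0" "r 3 \<noteq> 0"
    using p s3 by (auto simp: power2_eq_square)
  show "r i \<noteq> 0" using nz exhaust_3[of i] by auto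
  have ne: "r 1 \<noteq> r 2" "r 1 \<noteq> r 3" "r 2 \<noteq> r 3"
  proof -
    have "3 * (r 1)\<^sup>2 \<noteq> 0" "3 * (r 2)\<^sup>2 \<noteq> 0" using nz by auto
    moreover have "3 * (r 1)\<^sup>2 = 0" if "r 1 = r 2" using q that by algebra
    moreover have "3 * (r 1)\<^sup>2 = 0" if "r 1 = r 3" using q e that by algebra
    moreover have "3 * (r 2)\<^sup>2 = 0" if "r 2 = r 3" using q e that by algebra
    ultimately show "r 1 \<noteq> r 2" "r 1 \<noteq> r 3" "r 2 \<noteq> r 3" by blast+
  qed
  show "i \<noteq> j \<Longrightarrow> r i \<noteq> r j"
    using ne exhaust_3[of i] exhaust_3[of j] by auto
  have cubes: "cmod (r 1) ^ 3 = cmod (r 1 * r 2 * r 3)" "cmod (r 2) ^ 3 = cmod (r 1 * r 2 * r 3)"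
     "cmod (r 3) ^ 3 = cmod (r 1 * r 2 * r 3)"
  proof -
    have "r 1 ^ 3 = r 1 * r 2 * r 3" "r 2 ^ 3 = r 1 * r 2 * r 3" "r 3 ^ 3 = r 1 * r 2 * r 3"
      using p by algebra+
    then show "cmod (r 1) ^ 3 = cmod (r 1 * r 2 * r 3)" "cmod (r 2) ^ 3 = cmod (r 1 * r 2 * r 3)"
      "cmod (r 3) ^ 3 = cmod (r 1 * r 2 * r 3)"
      by (simp_all only: norm_power[symmetric])
  qed
  \<comment> \<open>\<open>power_inject_base\<close> compares powers with exponent
    \<open>Suc n\<close>, so \<open>n=2\<close> means cubes.\<close>
  have c: "cmod (r 1) = cmod (r 2)" "cmod (r 2) = cmod (r 3)"
    by (rule power_inject_base[where n=2]; use cubes in \<open>simp add: eval_nat_numeral\<close>)+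
  show "cmod (r i) = cmod (r j)"
    using c exhaust_3[of i] exhaust_3[of j] by auto
  have n: "r 1 * cnj (r 1) = r 2 * cnj (r 2)" "r 2 * cnj (r 2) = r 3 * cnj (r 3)"
    by (simp_all add: c flip: complex_norm_square)
  \<comment> \<open>Multiplying by a nonzero product reduces the claim to \<open>p\<close> and the
    equality of the moduli.\<close>
  have "r 2 * r 3 * (r 1 * cnj (r 2)) = r 2 * r 3 * (r 2 * cnj (r 3))"
  proof -
    have "r 2 * r 3 * (r 1 * cnj (r 2)) = r 1 * r 3 * (r 2 * cnj (r 2))" by simp
    also have "\<dots> = r 2 * r 3 * (r 2 * cnj (r 3))"
      unfolding p(1) n(2) by (simp add: power2_eq_square)
    finally show ?thesis .
  qed
  then show "r 1 * cnj (r 2) = r 2 * cnj (r 3)" using nz by simp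
  have "r 1 * r 3 * (r 2 * cnj (r 3)) = r 1 * r 3 * (r 3 * cnj (r 1))"
  proof -
    have "r 1 * r 3 * (r 2 * cnj (r 3)) = r 1 * r 2 * (r 3 * cnj (r 3))" by simp
    also have "\<dots> = r 1 * r 3 * (r 3 * cnj (r 1))"
      unfolding p(2) n[symmetric] by (simp add: power2_eq_square)
    finally show ?thesis .
  qed
  then show "r 2 * cnj (r 3) = r 3 * cnj (r 1)" using nz by simp
qed

context sd_frame
begin

lemma trace_sd_weyl_map:
  assumes W: "weyl_tensor g W" and eig: "\<And>i. sd_weyl_map s g W (U i) = tscale (\<rho> i) (U i)"
  shows "trace_on (self_dual_bivectors s g) (sd_weyl_map s g W ^^ n) = (\<Sum>i\<in>UNIV. \<rho> i ^ n)"
proof -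
  let ?\<phi> = "\<lambda>i F. - bivector_metric g F (U i)"
  have ind: "tensor2.independent (range U)" and span: "tensor2.span (range U) = self_dual_bivectors s g"
    using frame by (auto simp: orthonormal_sd_frame_def)
  have X: "sd_weyl s g W a b c d = (\<Sum>i\<in>UNIV. outer (U i) (tscale (- \<rho> i) (U i)) a b c d)" for a b c d
    unfolding sd_weyl_decomposition(1)[OF W eig] by (simp add: outer_def sum_negf mult_ac)
  have map: "sd_weyl_map s g W F = (\<Sum>i\<in>UNIV. tscale (\<rho> i * ?\<phi> i F) (U i))" for F
    unfolding sd_weyl_map_def
    by (subst contract_sum_outer[OF X])
      (simp add: vec_eq_iff bivector_metric_pairing pairing_commute[of "tscale _ _"] pairing_tscale
        pairing_commute[of F] sum_distrib_left sum_negf mult_ac del: tensor2.scale_minus_left)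
  \<comment> \<open>Self-duality of \<open>F\<close> enters at the zeroth power, where the formula
    is the frame expansion of \<open>F\<close> itself.\<close>
  have pow: "(sd_weyl_map s g W ^^ n) F = (\<Sum>i\<in>UNIV. tscale (\<rho> i ^ n * ?\<phi> i F) (U i))"
    if "F \<in> self_dual_bivectors s g" for F
  proof (induction n)
    case 0
    show ?case using self_dual_expand[OF that] by simp
  next
    case (Suc n)
    have "bivector_metric g (\<Sum>j\<in>UNIV. tscale (\<rho> j ^ n * ?\<phi> j F) (U j)) (U i) = - (\<rho> i ^ n * ?\<phi> i F)" for i
      unfolding bivector_metric_sum metric_U by (simp add: if_distrib[of "(*) _"] cong: if_cong)
    then show ?case
      by (simp only: funpow.simps o_apply Suc map[of "\<Sum>j\<in>UNIV. _ j"] minus_minus power_Suc mult.assoc)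
  qed
  show ?thesis
    by (rule trace_on_diagonal[where \<phi>="?\<phi>", OF ind span pow])
      (simp_all add: bivector_metric_sum[where F="\<lambda>v. v"] metric_U sum_negf)
qed

lemma bel_robinson_eq:
  assumes "\<And>a b c d. sd_weyl s g W a b c d = - (\<Sum>i\<in>UNIV. \<rho> i * outer (U i) (U i) a b c d)"
  shows "bel_robinson s g W a m b n = (\<Sum>i\<in>UNIV. \<Sum>j\<in>UNIV. \<rho> i * cnj (\<rho> j) * outer (Pi i j) (Pi i j) a m b n)"
proof -
  \<comment> \<open>The sign comes from reversing the indices of the conjugate factor; it occurs
    twice in the Bel-Robinson tensor and cancels.\<close>
  have h: "(\<Sum>k\<in>UNIV. \<Sum>p\<in>UNIV. U i $ a $ k * ginv g k p * cnj (U j $ m $ p)) = - Pi i j $ a $ m" for i j a m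
  proof -
    have "Pi i j $ a $ m = (\<Sum>p\<in>UNIV. \<Sum>k\<in>UNIV. U i $ a $ k * ginv g k p * tconj (U j) $ p $ m)"
      by (simp add: Pi_def matrix_matrix_mult_def sum_distrib_right)
    also have "\<dots> = (\<Sum>k\<in>UNIV. \<Sum>p\<in>UNIV. U i $ a $ k * ginv g k p * (- cnj (U j $ m $ p)))"
      by (subst sum.swap) (simp add: antisymmetric_nth[OF transpose_U, of _ _ m])
    finally show ?thesis by (simp add: sum_negf)
  qed
  have "bel_robinson s g W a m b n = (\<Sum>k\<in>UNIV. \<Sum>p\<in>UNIV. \<Sum>l\<in>UNIV. \<Sum>q\<in>UNIV. \<Sum>i\<in>UNIV. \<Sum>j\<in>UNIV.
      \<rho> i * cnj (\<rho> j) * ((U i $ a $ k * ginv g k p * cnj (U j $ m $ p)) * (U i $ b $ l * ginv g l q * cnj (U j $ n $ q))))"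
  proof -
    have "sd_weyl s g W a k b l * ginv g k p * ginv g l q * cnj (sd_weyl s g W m p n q) =
      (\<Sum>i\<in>UNIV. \<Sum>j\<in>UNIV. \<rho> i * cnj (\<rho> j) *
        ((U i $ a $ k * ginv g k p * cnj (U j $ m $ p)) * (U i $ b $ l * ginv g l q * cnj (U j $ n $ q))))" for k p l q
    proof -
      have "sd_weyl s g W a k b l * ginv g k p * ginv g l q * cnj (sd_weyl s g W m p n q) = ginv g k p * ginv g l q *
        ((\<Sum>i\<in>UNIV. \<rho> i * outer (U i) (U i) a k b l) * (\<Sum>j\<in>UNIV. cnj (\<rho> j * outer (U j) (U j) m p n q)))"
        by (simp add: assms mult_ac)
      also have "\<dots> = (\<Sum>i\<in>UNIV. \<Sum>j\<in>UNIV. \<rho> i * cnj (\<rho> j) *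
        ((U i $ a $ k * ginv g k p * cnj (U j $ m $ p)) * (U i $ b $ l * ginv g l q * cnj (U j $ n $ q))))"
        unfolding sum_product unfolding sum_distrib_left by (intro sum.cong refl) (simp add: outer_def mult_ac)
      finally show ?thesis .
    qed
    then show ?thesis by (simp only: bel_robinson_def)
  qed
  also have "\<dots> = (\<Sum>i\<in>UNIV. \<Sum>j\<in>UNIV. \<Sum>k\<in>UNIV. \<Sum>p\<in>UNIV. \<Sum>l\<in>UNIV. \<Sum>q\<in>UNIV.
      \<rho> i * cnj (\<rho> j) * ((U i $ a $ k * ginv g k p * cnj (U j $ m $ p)) * (U i $ b $ l * ginv g l q * cnj (U j $ n $ q))))"
    by (rule trans[OF _ sum_swap_pairs]) (intro sum.cong refl sum_swap_pairs)
  also have "\<dots> = (\<Sum>i\<in>UNIV. \<Sum>j\<in>UNIV. \<rho> i * cnj (\<rho> j) *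
      ((\<Sum>k\<in>UNIV. \<Sum>p\<in>UNIV. U i $ a $ k * ginv g k p * cnj (U j $ m $ p)) *
       (\<Sum>l\<in>UNIV. \<Sum>q\<in>UNIV. U i $ b $ l * ginv g l q * cnj (U j $ n $ q))))"
    by (simp only: sum_distrib_right) (simp only: sum_distrib_left)
  also have "\<dots> = (\<Sum>i\<in>UNIV. \<Sum>j\<in>UNIV. \<rho> i * cnj (\<rho> j) * outer (Pi i j) (Pi i j) a m b n)"
    unfolding h by (simp add: outer_def)
  finally show ?thesis .
qed

text \<open>Index pairs are merged into one index \<open>p\<close>, so that the nine tensors form a
  single orthonormal family.\<close>

lemma bel_robinson_map_eq:
  assumes "\<And>a b c d. sd_weyl s g W a b c d = - (\<Sum>i\<in>UNIV. \<rho> i * outer (U i) (U i) a b c d)"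
  shows "bel_robinson_map s g W A = (\<Sum>p\<in>UNIV. tscale (\<rho> (fst p) * cnj (\<rho> (snd p)) * pairing g (case_prod Pi p) A) (case_prod Pi p))"
proof -
  have "bel_robinson s g W a m b n =
      (\<Sum>p\<in>UNIV. outer (tscale (\<rho> (fst p) * cnj (\<rho> (snd p))) (case_prod Pi p)) (case_prod Pi p) a m b n)" for a m b n
    unfolding bel_robinson_eq[OF assms]
    by (simp add: sum.cartesian_product outer_def split_def mult_ac)
  note * = contract_sum_outer[OF this]
  show ?thesis
    unfolding bel_robinson_map_def * by (simp add: vec_eq_iff mult_ac)
qed

section \<open>Spectral decomposition of the Bel-Robinson map\<close>

lemma pairing_Pi': "pairing g (case_prod Pi p) (case_prod Pi q) = (if p = q then 1 else 0)"
  by (simp add: split_def pairing_Pi prod_eq_iff)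

lemma inj_Pi: "inj (case_prod Pi)"
proof (rule injI)
  fix p q assume "case_prod Pi p = case_prod Pi q"
  then have "pairing g (case_prod Pi p) (case_prod Pi q) = 1"
    using pairing_Pi'[of q q] by simp
  then show "p = q" unfolding pairing_Pi' by (simp split: if_splits)
qed

lemma independent_Pi: "tensor2.independent (case_prod Pi ` S)"
proof -
  have "u v = 0" if "(\<Sum>v\<in>case_prod Pi ` S. tscale (u v) v) = 0" "v \<in> case_prod Pi ` S" for u v
  proof -
    from that(2) obtain q where q: "q \<in> S" "v = case_prod Pi q" by blast
    have "(\<Sum>p\<in>S. tscale (u (case_prod Pi p)) (case_prod Pi p)) = 0"
      using that(1) by (simp add: sum.reindex inj_on_subset[OF inj_Pi] del: split_paired_All)
    then have "pairing g (case_prod Pi q) (\<Sum>p\<in>S. tscale (u (case_prod Pi p)) (case_prod Pi p)) = 0"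
      by (simp add: pairing_def)
    then show ?thesis
      unfolding pairing_sum pairing_Pi' using q by (simp add: if_distrib[of "(*) _"] cong: if_cong)
  qed
  then show ?thesis by (subst tensor2.dependent_finite) auto
qed

lemma bel_robinson_eigenspace_eq:
  assumes X: "\<And>a b c d. sd_weyl s g W a b c d = - (\<Sum>i\<in>UNIV. \<rho> i * outer (U i) (U i) a b c d)"
    and "\<kappa> \<noteq> 0" and S: "\<And>p. \<rho> (fst p) * cnj (\<rho> (snd p)) = \<kappa> \<longleftrightarrow> p \<in> S"
  shows "bel_robinson_eigenspace s g W \<kappa> = tensor2.span (case_prod Pi ` S)"
    and "tensor2.dim (bel_robinson_eigenspace s g W \<kappa>) = card S"
proof -
  let ?T = "bel_robinson_map s g W" and ?E = "bel_robinson_eigenspace s g W \<kappa>"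
  let ?P = "case_prod Pi"
  note T = bel_robinson_map_eq[OF X]
  show E: "?E = tensor2.span (?P ` S)"
  proof
    show "?E \<subseteq> tensor2.span (?P ` S)"
    proof
      fix A assume "A \<in> ?E"
      then have A: "?T A = tscale \<kappa> A" by (simp add: bel_robinson_eigenspace_def)
      \<comment> \<open>Pairing the eigenvalue equation with each member of the family annihilates
        the components outside \<open>S\<close>.\<close>
      have ev: "\<rho> (fst q) * cnj (\<rho> (snd q)) * pairing g (?P q) A = \<kappa> * pairing g (?P q) A" for q
      proof -
        have "pairing g (?P q) (?T A) = \<rho> (fst q) * cnj (\<rho> (snd q)) * pairing g (?P q) A"
          unfolding T pairing_sum pairing_Pi' by (simp add: if_distrib[of "(*) _"] cong: if_cong)
        then show ?thesis unfolding A pairing_tscale by (rule sym)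
      qed
      have zero: "pairing g (?P q) A = 0" if "q \<notin> S" for q
        using ev[of q] that S[of q] unfolding mult_cancel_right by blast
      have "?T A \<in> tensor2.span (?P ` S)"
        unfolding T
      proof (rule tensor2.span_sum)
        fix p :: "3 \<times> 3"
        show "tscale (\<rho> (fst p) * cnj (\<rho> (snd p)) * pairing g (?P p) A) (?P p) \<in> tensor2.span (?P ` S)"
        proof (cases "p \<in> S")
          case True
          then show ?thesis by (intro tensor2.span_scale tensor2.span_base imageI)
        next
          case False
          then show ?thesis by (simp add: zero tensor2.span_zero)
        qed
      qed
      \<comment> \<open>A nonzero eigenvalue makes \<open>A\<close> a multiple of its image, which
        lies in the span.\<close>
      then have "tscale (1 / \<kappa>) (?T A) \<in> tensor2.span (?P ` S)"
        by (rule tensor2.span_scale)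
      then show "A \<in> tensor2.span (?P ` S)"
        using \<open>\<kappa> \<noteq> 0\<close> by (simp add: A)
    qed
    have "?P ` S \<subseteq> ?E"
    proof safe
      fix i j assume "(i, j) \<in> S"
      then have "\<rho> i * cnj (\<rho> j) = \<kappa>" using S[of "(i, j)"] by simp
      moreover have "?T (Pi i j) = tscale (\<rho> i * cnj (\<rho> j)) (Pi i j)"
        unfolding T using pairing_Pi'[of _ "(i, j)"]
        by (simp add: if_distrib[of "(*) _"] if_distrib[of "\<lambda>c. tscale c _"] cong: if_cong)
      ultimately show "Pi i j \<in> ?E"
        by (simp add: bel_robinson_eigenspace_def Pi_traceless_symmetric)
    qed
    moreover have "tensor2.subspace ?E"
      unfolding tensor2.subspace_def bel_robinson_eigenspace_def T traceless_symmetric_def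
      by (auto simp: pairing_add pairing_tscale transpose_add vec_eq_iff sum.distrib distrib_left
          sum_distrib_left[symmetric] mult_ac pairing_def[of _ _ 0] transpose_def[of 0]
          simp flip: sum_distrib_left)
    ultimately show "tensor2.span (?P ` S) \<subseteq> ?E"
      by (rule tensor2.span_minimal)
  qed
  show "tensor2.dim ?E = card S"
    unfolding E tensor2.dim_span_eq_card_independent[OF independent_Pi]
    by (simp add: card_image inj_on_subset[OF inj_Pi])
qed

end

theorem proposition8:
  fixes g :: "real^4^4" and s :: real and W :: real_tensor4
    and U :: "3 \<Rightarrow> tensor2" and \<rho> :: "3 \<Rightarrow> complex"
    and t :: real and \<tau> :: complex and Pi1 :: "3 \<Rightarrow> tensor2" and Pi2 :: "3 \<Rightarrow> 3 \<Rightarrow> tensor2"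
  assumes "lorentzian g"
    and "s = 1 \<or> s = - 1"
    and "weyl_tensor g W"
    and "type_IM_minus6 s g W"
    and "orthonormal_sd_frame s g U"
    and "\<And>i. sd_weyl_map s g W (U i) = tscale (\<rho> i) (U i)"
    and "t = (cmod (\<rho> 1))\<^sup>2"
    and "\<tau> = \<rho> 1 * cnj (\<rho> 2)"
    and "\<And>i. Pi1 i = tprod g (U i) (tconj (U i))"
    and "\<And>j k. Pi2 j k = tprod g (U j) (tconj (U k))"
  shows
    "(\<forall>a b c d. sd_weyl s g W a b c d = - (\<Sum>i\<in>UNIV. \<rho> i * outer (U i) (U i) a b c d)) \<and>
     t = (cmod (\<rho> 2))\<^sup>2 \<and> t = (cmod (\<rho> 3))\<^sup>2 \<and>
     \<tau> = \<rho> 2 * cnj (\<rho> 3) \<and> \<tau> = \<rho> 3 * cnj (\<rho> 1) \<and>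
     (\<forall>a m b n. bel_robinson s g W a m b n =
         complex_of_real t *
           (outer (Pi1 1) (Pi1 1) a m b n + outer (Pi1 2) (Pi1 2) a m b n
             + outer (Pi1 3) (Pi1 3) a m b n)
       + \<tau> *
           (outer (Pi2 1 2) (Pi2 1 2) a m b n + outer (Pi2 2 3) (Pi2 2 3) a m b n
             + outer (Pi2 3 1) (Pi2 3 1) a m b n)
       + cnj \<tau> *
           (outer (Pi2 2 1) (Pi2 2 1) a m b n + outer (Pi2 3 2) (Pi2 3 2) a m b n
             + outer (Pi2 1 3) (Pi2 1 3) a m b n)) \<and>
     bel_robinson_eigenspace s g W (complex_of_real t) = tensor2.span {Pi1 1, Pi1 2, Pi1 3} \<and>
     tensor2.dim (bel_robinson_eigenspace s g W (complex_of_real t)) = 3 \<and>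
     bel_robinson_eigenspace s g W \<tau> = tensor2.span {Pi2 1 2, Pi2 2 3, Pi2 3 1} \<and>
     tensor2.dim (bel_robinson_eigenspace s g W \<tau>) = 3 \<and>
     bel_robinson_eigenspace s g W (cnj \<tau>) = tensor2.span {Pi2 2 1, Pi2 3 2, Pi2 1 3} \<and>
     tensor2.dim (bel_robinson_eigenspace s g W (cnj \<tau>)) = 3"
proof -
  interpret sd_frame g s U
    by unfold_locales (use assms(1,2,5) in auto)
  have X: "sd_weyl s g W a b c d = - (\<Sum>i\<in>UNIV. \<rho> i * outer (U i) (U i) a b c d)" for a b c d
    by (rule sd_weyl_decomposition(1)[OF assms(3,6)])
  have s1: "\<rho> 1 + \<rho> 2 + \<rho> 3 = 0"
    using sd_weyl_decomposition(2)[OF assms(3,6)] by (simp add: sum_3)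
  have a: "weyl_a s g W = (\<rho> 1)\<^sup>2 + (\<rho> 2)\<^sup>2 + (\<rho> 3)\<^sup>2"
    unfolding weyl_a_def trace_sd_weyl_map[OF assms(3,6)] by (rule sum_3)
  have b: "weyl_b s g W = \<rho> 1 ^ 3 + \<rho> 2 ^ 3 + \<rho> 3 ^ 3"
    unfolding weyl_b_def trace_sd_weyl_map[OF assms(3,6)] by (rule sum_3)
  have s3: "\<rho> 1 ^ 3 + \<rho> 2 ^ 3 + \<rho> 3 ^ 3 \<noteq> 0"
    using assms(4) b by (simp add: type_IM_minus6_def)
  \<comment> \<open>As \<open>weyl_b\<close> is nonzero, the value -6 of the invariant forces
    \<open>weyl_a\<close> to vanish.\<close>
  have s2: "(\<rho> 1)\<^sup>2 + (\<rho> 2)\<^sup>2 + (\<rho> 3)\<^sup>2 = 0"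
    using assms(4) by (auto simp: type_IM_minus6_def weyl_M_def simp flip: a)
  note R = cube_root_relations[of \<rho>, OF s1 s2 s3]
  have Pi1: "Pi1 i = Pi i i" and Pi2: "Pi2 i j = Pi i j" for i j
    by (simp_all add: assms(9,10) tprod_eq Pi_def)
  have t: "t = (cmod (\<rho> 2))\<^sup>2" "t = (cmod (\<rho> 3))\<^sup>2"
    using R(3)[of 1 2] R(3)[of 1 3] assms(7) by simp_all
  have diag: "\<rho> 1 * cnj (\<rho> 1) = t" "\<rho> 2 * cnj (\<rho> 2) = t" "\<rho> 3 * cnj (\<rho> 3) = t"
    by ((subst assms(7), simp only: complex_norm_square), (subst t(1), simp only: complex_norm_square),
      (subst t(2), simp only: complex_norm_square))
  have \<tau>: "\<rho> 1 * cnj (\<rho> 2) = \<tau>" "\<rho> 2 * cnj (\<rho> 3) = \<tau>" "\<rho> 3 * cnj (\<rho> 1) = \<tau>"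
    using R(4,5) assms(8) by simp_all
  have \<tau>': "\<rho> 2 * cnj (\<rho> 1) = cnj \<tau>" "\<rho> 3 * cnj (\<rho> 2) = cnj \<tau>" "\<rho> 1 * cnj (\<rho> 3) = cnj \<tau>"
    using \<tau>[THEN arg_cong, of cnj] by (simp_all add: mult.commute)
  have nz: "complex_of_real t \<noteq> 0" "\<tau> \<noteq> 0" "cnj \<tau> \<noteq> 0"
    using diag(1) \<tau>(1) \<tau>'(1) R(1) by (metis complex_cnj_zero_iff mult_eq_0_iff)+
  have ne: "complex_of_real t \<noteq> \<tau>" "\<tau> \<noteq> cnj \<tau>" "complex_of_real t \<noteq> cnj \<tau>"
  proof -
    \<comment> \<open>Each two of the three values are written with a common nonzero conjugate
      factor, so distinct eigenvalues give distinct products.\<close>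
    have "\<rho> 2 * cnj (\<rho> 2) \<noteq> \<rho> 1 * cnj (\<rho> 2)" "\<rho> 1 * cnj (\<rho> 2) \<noteq> \<rho> 3 * cnj (\<rho> 2)"
      "\<rho> 1 * cnj (\<rho> 1) \<noteq> \<rho> 2 * cnj (\<rho> 1)"
      using R(1) R(2)[of 1 2] R(2)[of 1 3] by simp_all
    then show "complex_of_real t \<noteq> \<tau>" "\<tau> \<noteq> cnj \<tau>" "complex_of_real t \<noteq> cnj \<tau>"
      by (simp_all only: diag \<tau> \<tau>' not_False_eq_True)
  qed
  note table = diag \<tau> \<tau>' ne ne[symmetric]
  let ?S = "{(1, 1), (2, 2), (3, 3)} :: (3 \<times> 3) set"
  let ?S\<tau> = "{(1, 2), (2, 3), (3, 1)} :: (3 \<times> 3) set"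
  let ?S\<tau>' = "{(2, 1), (3, 2), (1, 3)} :: (3 \<times> 3) set"
  \<comment> \<open>The nine products fall into three classes of three; distinctness of the values
    makes each class exact, which gives the dimensions.\<close>
  have "\<forall>i j. \<rho> i * cnj (\<rho> j) = complex_of_real t \<longleftrightarrow> (i, j) \<in> ?S"
    "\<forall>i j. \<rho> i * cnj (\<rho> j) = \<tau> \<longleftrightarrow> (i, j) \<in> ?S\<tau>"
    "\<forall>i j. \<rho> i * cnj (\<rho> j) = cnj \<tau> \<longleftrightarrow> (i, j) \<in> ?S\<tau>'"
    unfolding forall_3 table by (simp_all add: ne ne[symmetric])
  then have S: "\<rho> (fst p) * cnj (\<rho> (snd p)) = complex_of_real t \<longleftrightarrow> p \<in> ?S"
    "\<rho> (fst p) * cnj (\<rho> (snd p)) = \<tau> \<longleftrightarrow> p \<in> ?S\<tau>"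
    "\<rho> (fst p) * cnj (\<rho> (snd p)) = cnj \<tau> \<longleftrightarrow> p \<in> ?S\<tau>'" for p
    by (metis prod.collapse)+
  note E = bel_robinson_eigenspace_eq[OF X]
  have BR: "bel_robinson s g W a m b n =
         complex_of_real t *
           (outer (Pi1 1) (Pi1 1) a m b n + outer (Pi1 2) (Pi1 2) a m b n
             + outer (Pi1 3) (Pi1 3) a m b n)
       + \<tau> *
           (outer (Pi2 1 2) (Pi2 1 2) a m b n + outer (Pi2 2 3) (Pi2 2 3) a m b n
             + outer (Pi2 3 1) (Pi2 3 1) a m b n)
       + cnj \<tau> *
           (outer (Pi2 2 1) (Pi2 2 1) a m b n + outer (Pi2 3 2) (Pi2 3 2) a m b n
             + outer (Pi2 1 3) (Pi2 1 3) a m b n)" for a m b n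
    unfolding bel_robinson_eq[OF X] sum_3 table Pi1 Pi2 by (simp only: distrib_left ac_simps)
  have span: "bel_robinson_eigenspace s g W (complex_of_real t) = tensor2.span {Pi1 1, Pi1 2, Pi1 3}"
    "bel_robinson_eigenspace s g W \<tau> = tensor2.span {Pi2 1 2, Pi2 2 3, Pi2 3 1}"
    "bel_robinson_eigenspace s g W (cnj \<tau>) = tensor2.span {Pi2 2 1, Pi2 3 2, Pi2 1 3}"
    by (simp_all add: E(1)[OF nz(1) S(1)] E(1)[OF nz(2) S(2)] E(1)[OF nz(3) S(3)] Pi1 Pi2)
  have dim: "tensor2.dim (bel_robinson_eigenspace s g W (complex_of_real t)) = 3"
    "tensor2.dim (bel_robinson_eigenspace s g W \<tau>) = 3"
    "tensor2.dim (bel_robinson_eigenspace s g W (cnj \<tau>)) = 3"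
    by (simp_all add: E(2)[OF nz(1) S(1)] E(2)[OF nz(2) S(2)] E(2)[OF nz(3) S(3)])
  show ?thesis
    using X t \<tau> BR span dim by (intro conjI allI) simp_all
qed

end
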